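(* There exist constants $C_0$ and $n_0$ such that for all $C\ge C_0$ and all $n\ge n_0$ the following holds. Let $G$ be an edge-colored graph on $n$ vertices with minimum degree $\delta\ge C\log n$, and let $\lambda_1$ be the second-smallest eigenvalue of the normalized Laplacian of $G$. If each color class (the set of edges of a given color) has size at most $\delta\lambda_1/2$, then $G$ contains at least $\left\lfloor \frac{\delta\lambda_1}{C\log n}\right\rfloor$ pairwise edge-disjoint rainbow spanning trees.
   Context: Graphs are finite and simple; $\log$ is the natural logarithm. An edge-coloring is an arbitrary assignment of colors to edges (it need not be proper). A rainbow spanning tree is a spanning tree all of whose edges have different colors. The normalized Laplacian of $G$ is the matrix $\mathcal{L}$ indexed by $V(G)$ with $\mathcal{L}(u,u)=1$ if $\deg(u)\ne 0$, $\mathcal{L}(u,v)=-1/\sqrt{\deg(u)\deg(v)}$ if $u$ and $v$ are adjacent, and $0$ otherwise. Its eigenvalues, with multiplicity, are $0=\lambda_0\le\lambda_1\le\dots\le\lambda_{n-1}\le 2$. *)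

theory Defs
  imports Complex_Main "HOL-Library.Multiset" "Jordan_Normal_Form.Char_Poly"
begin

definition simple_graph :: "'v set \<Rightarrow> 'v set set \<Rightarrow> bool" where
  "simple_graph V E \<longleftrightarrow> finite V \<and> (\<forall>e\<in>E. e \<subseteq> V \<and> card e = 2)"

definition degree_of :: "'v set set \<Rightarrow> 'v \<Rightarrow> nat" where
  "degree_of E v = card {e \<in> E. v \<in> e}"

definition min_degree :: "'v set \<Rightarrow> 'v set set \<Rightarrow> nat" where
  "min_degree V E = Min (degree_of E ` V)"

definition norm_laplacian :: "'v set set \<Rightarrow> 'v \<Rightarrow> 'v \<Rightarrow> real" where
  "norm_laplacian E u v =
     (if u = v then (if degree_of E u \<noteq> 0 then 1 else 0)
      else if {u, v} \<in> E then - 1 / sqrt (real (degree_of E u) * real (degree_of E v))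
      else 0)"

(* Matrices of the library are indexed by natural numbers, so a V-indexed matrix is
   transported along an arbitrary enumeration of V. A different enumeration conjugates the
   matrix by a permutation matrix, so the spectrum does not depend on the choice. *)
definition vertex_enum :: "'v set \<Rightarrow> 'v list" where
  "vertex_enum V = (SOME vs. distinct vs \<and> set vs = V)"

definition matrix_on :: "'v set \<Rightarrow> ('v \<Rightarrow> 'v \<Rightarrow> real) \<Rightarrow> real mat" where
  "matrix_on V M = mat (card V) (card V) (\<lambda>(i, j). M (vertex_enum V ! i) (vertex_enum V ! j))"

(* Increasing list of the real eigenvalues with algebraic multiplicity; a symmetric real
   matrix of dimension n has exactly n of them. *)
definition sorted_eigenvalues :: "real mat \<Rightarrow> real list" where
  "sorted_eigenvalues A = sorted_list_of_multiset (proots (char_poly A))"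

(* The list is indexed from 0, so index 1 is the second-smallest eigenvalue.
   Meaningful only for card V >= 2. *)
definition lambda1 :: "'v set \<Rightarrow> 'v set set \<Rightarrow> real" where
  "lambda1 V E = sorted_eigenvalues (matrix_on V (norm_laplacian E)) ! 1"

definition connected_graph :: "'v set \<Rightarrow> 'v set set \<Rightarrow> bool" where
  "connected_graph V E \<longleftrightarrow>
     V \<noteq> {} \<and> (\<forall>u\<in>V. \<forall>v\<in>V. (u, v) \<in> {(x, y). {x, y} \<in> E}\<^sup>*)"

definition is_cycle :: "'v set set \<Rightarrow> 'v list \<Rightarrow> bool" where
  "is_cycle E p \<longleftrightarrow>
     length p \<ge> 3 \<and> distinct p \<and>
     (\<forall>i < length p. {p ! i, p ! (Suc i mod length p)} \<in> E)"

definition is_tree :: "'v set \<Rightarrow> 'v set set \<Rightarrow> bool" where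
  "is_tree V E \<longleftrightarrow> simple_graph V E \<and> connected_graph V E \<and> (\<nexists>p. is_cycle E p)"

(* A spanning tree of (V, E) is identified with its edge set. *)
definition spanning_tree :: "'v set \<Rightarrow> 'v set set \<Rightarrow> 'v set set \<Rightarrow> bool" where
  "spanning_tree V E T \<longleftrightarrow> T \<subseteq> E \<and> is_tree V T"

definition rainbow :: "('v set \<Rightarrow> 'c) \<Rightarrow> 'v set set \<Rightarrow> bool" where
  "rainbow \<phi> T \<longleftrightarrow> inj_on \<phi> T"

definition color_class :: "'v set set \<Rightarrow> ('v set \<Rightarrow> 'c) \<Rightarrow> 'c \<Rightarrow> 'v set set" where
  "color_class E \<phi> k = {e \<in> E. \<phi> e = k}"

end

theory Submission
  imports Defs "HOL-Analysis.Function_Topology" "HOL-Analysis.Convex"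
    "Jordan_Normal_Form.Schur_Decomposition"
begin

text \<open>
  Write \<open>n\<close> for the number of vertices, \<open>\<delta>\<close> for the minimum degree and \<open>M = \<delta> \<lambda>\<^sub>1 / 2\<close> for the
  bound on the colour classes. Give every edge independently one of \<open>t = \<lfloor>2 M / (C log n)\<rfloor>\<close> labels,
  uniformly at random. With positive probability each of the \<open>t\<close> label classes contains a rainbow
  spanning tree, and these trees are edge-disjoint.

  A graph has a rainbow spanning tree as soon as, for every partition of its vertices into \<open>s\<close>
  parts, the edges between different parts show at least \<open>s - 1\<close> colours. This is Rado's theorem on
  independent transversals for the graphic matroid; it follows from submodularity of the number of
  components (\<open>num_comp_submodular\<close>, \<open>rado_rainbow_connected\<close>). So it suffices to exclude, for every
  label and every partition, that at most \<open>s - 2\<close> colours appear.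

  The eigenvalue enters through the number of edges across a cut, which is at least
  \<open>\<lambda>\<^sub>1 \<delta> |S| (n - |S|) / n\<close> (\<open>cut_edges_lower_bound\<close>). Summed over the parts of a partition this shows
  that at least \<open>M (s - 1 + k a / n)\<close> edges run between different parts, where \<open>k = n - s\<close> and \<open>a\<close> is
  the number of vertices outside a largest part (\<open>crossing_lower_bound\<close>). The term \<open>s - 1\<close> cannot be
  improved by a constant factor: the complete graph on a large even number of vertices, coloured by
  \<open>n - 1\<close> perfect matchings, satisfies the hypothesis with equality, and each spanning tree must use
  all its colours. Hence an average number of colours is not enough, and one needs a large deviation
  bound that loses almost nothing.

  Such a bound comes from the exponential moment of the number of colours with a very small base
  \<open>z = n powr (- C / 4)\<close>. A colour with \<open>m \<le> M\<close> crossing edges contributes a factor of at most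
  \<open>z + (1 - z) exp (- m / t)\<close>, which is log-convex in \<open>m\<close> and therefore at most
  \<open>(z (1 + z)) powr (m / M)\<close>. The product depends only on the total number of crossing edges, and the
  event that a given partition is bad for a given label has probability at most
  \<open>3 z powr (1 + k a / n)\<close> (\<open>few_colors_card_le\<close>, \<open>exists_good_assignment\<close>).

  The excess \<open>k a / n\<close> pays for the union bound. Since \<open>k + a \<ge> n - 1\<close>, it is at least
  \<open>min k a / 4\<close>, and a partition can be described by a partial function on \<open>min k a\<close> vertices
  (\<open>equiv_encode\<close>), so that the partitions weighted by \<open>n\<close> to the power \<open>- 3 min k a\<close> have bounded
  total weight (\<open>sum_coarseness_weights\<close>).
\<close>

section \<open>Components of a graph as a submodular function\<close>

text \<open>
  The closure is cut down to \<open>V \<times> V\<close> so that it is an equivalence relation on \<open>V\<close> whatever \<open>F\<close> is,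
  and its classes are the vertex sets of the components.
\<close>

definition reach :: "'v set \<Rightarrow> 'v set set \<Rightarrow> ('v \<times> 'v) set" where
  "reach V F = {(x, y). x \<in> V \<and> y \<in> V \<and> (x, y) \<in> {(a, b). {a, b} \<in> F}\<^sup>*}"

definition num_comp :: "'v set \<Rightarrow> 'v set set \<Rightarrow> nat" where
  "num_comp V F = card (V // reach V F)"

lemma equiv_reach: "equiv V (reach V F)"
proof (rule equivI)
  have "sym {(a, b). {a, b} \<in> F}"
    by (auto simp: sym_def insert_commute)
  then show "sym (reach V F)"
    by (auto simp: reach_def dest: symD[OF sym_rtrancl] intro!: symI)
  show "trans (reach V F)"
    by (auto simp: reach_def intro!: transI)
  show "refl_on V (reach V F)"
    by (auto simp: reach_def refl_on_def)
  show "reach V F \<subseteq> V \<times> V"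
    by (auto simp: reach_def)
qed

lemma reach_refl: "x \<in> V \<Longrightarrow> (x, x) \<in> reach V F"
  by (auto simp: reach_def)

lemma reach_sym: "(x, y) \<in> reach V F \<Longrightarrow> (y, x) \<in> reach V F"
  using equiv_reach[of V F] by (meson equivE symE)

lemma reach_trans: "(x, y) \<in> reach V F \<Longrightarrow> (y, z) \<in> reach V F \<Longrightarrow> (x, z) \<in> reach V F"
  using equiv_reach[of V F] by (meson equivE transE)

lemma reach_mono: "F \<subseteq> F' \<Longrightarrow> reach V F \<subseteq> reach V F'"
  unfolding reach_def using rtrancl_mono[of "{(a, b). {a, b} \<in> F}" "{(a, b). {a, b} \<in> F'}"] by auto

lemma edge_in_reach: "{u, v} \<in> F \<Longrightarrow> u \<in> V \<Longrightarrow> v \<in> V \<Longrightarrow> (u, v) \<in> reach V F"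
  by (auto simp: reach_def)

lemma reach_insert:
  assumes F: "F \<subseteq> Pow V" and uv: "u \<in> V" "v \<in> V"
  defines "M \<equiv> reach V F `` {u} \<union> reach V F `` {v}"
  shows "reach V (insert {u, v} F) = reach V F \<union> M \<times> M"
proof
  let ?R = "reach V F" and ?R' = "reach V (insert {u, v} F)"
  note tr = reach_trans[of _ _ V F] and sy = reach_sym[of _ _ V F] and rf = reach_refl[of _ V F]
  show "?R' \<subseteq> ?R \<union> M \<times> M"
  proof (rule subrelI)
    fix x y assume xy: "(x, y) \<in> ?R'"
    have "(x, y) \<in> ?R \<union> M \<times> M"
      if "(x, y) \<in> {(a, b). {a, b} \<in> insert {u, v} F}\<^sup>*" "x \<in> V"
      using that
    proof (induction rule: rtrancl_induct)
      case base
      then show ?case using rf by auto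
    next
      case (step y z)
      then have IH: "(x, y) \<in> ?R \<union> M \<times> M" by auto
      have yV: "y \<in> V" using IH by (auto simp: reach_def M_def)
      consider "{y, z} \<in> F" | "{y, z} = {u, v}" using step.hyps by auto
      then show ?case
      proof cases
        case 1
        then have "(y, z) \<in> ?R" using F yV by (auto simp: reach_def)
        then show ?thesis using IH tr[of _ y z] by (auto simp: M_def)
      next
        case 2
        then have yz: "y \<in> M" "z \<in> M" using rf uv by (auto simp: M_def doubleton_eq_iff)
        from IH show ?thesis
        proof
          assume "(x, y) \<in> ?R"
          then have "(w, y) \<in> ?R \<Longrightarrow> (w, x) \<in> ?R" for w using sy tr by blast
          then have "x \<in> M" using yz(1) by (auto simp: M_def)
          then show ?thesis using yz by auto
        qed (use yz in auto)
      qed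
    qed
    then show "(x, y) \<in> ?R \<union> M \<times> M" using xy by (auto simp: reach_def)
  qed
  have uv': "(u, v) \<in> ?R'" using uv by (auto intro: edge_in_reach)
  have sub: "?R \<subseteq> ?R'" by (rule reach_mono) auto
  have "(u, z) \<in> ?R'" if "z \<in> M" for z
    using that uv' sub reach_trans[of u v V "insert {u, v} F" z] by (auto simp: M_def)
  then have "(x, y) \<in> ?R'" if "x \<in> M" "y \<in> M" for x y
    using that by (meson reach_sym reach_trans)
  then show "?R \<union> M \<times> M \<subseteq> ?R'" using sub by auto
qed

lemma finite_quotient_reach: "finite V \<Longrightarrow> finite (V // reach V F)"
  by (rule finite_quotient) (auto simp: reach_def)

text \<open>
  A new edge merges the classes of its two ends.
\<close>

lemma num_comp_insert:
  assumes V: "finite V" and F: "F \<subseteq> Pow V" and uv: "u \<in> V" "v \<in> V"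
  shows "num_comp V F = num_comp V (insert {u, v} F) + (if (u, v) \<in> reach V F then 0 else 1)"
proof -
  let ?R = "reach V F" and ?R' = "reach V (insert {u, v} F)"
  note eq = equiv_reach[of V F]
  define M where "M = ?R `` {u} \<union> ?R `` {v}"
  have R': "?R' = ?R \<union> M \<times> M" unfolding M_def by (rule reach_insert[OF F uv])
  show ?thesis
  proof (cases "(u, v) \<in> ?R")
    case True
    have "M \<times> M \<subseteq> ?R"
      unfolding M_def using True by (blast dest: reach_sym intro: reach_trans)
    then show ?thesis using True R' by (simp add: num_comp_def Un_absorb2)
  next
    case False
    let ?u = "?R `` {u}" and ?v = "?R `` {v}"
    have ne: "?u \<noteq> ?v" using False eq uv by (simp add: eq_equiv_class_iff)
    have in_q: "?u \<in> V // ?R" "?v \<in> V // ?R" using uv by (auto intro: quotientI)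
    have disj: "?u \<inter> ?v = {}" using ne in_q eq quotient_disj by blast
    have uu: "u \<in> ?u" "v \<in> ?v" using uv by (auto intro: reach_refl)
    have cls: "?R' `` {x} = (if x \<in> M then M else ?R `` {x})" if "x \<in> V" for x
    proof (cases "x \<in> M")
      case True
      then have "?R `` {x} \<subseteq> M" unfolding M_def by (blast dest: reach_sym intro: reach_trans)
      then show ?thesis using True R' by auto
    qed (use R' in auto)
    have "V // ?R' = insert M (V // ?R - {?u, ?v})"
    proof (intro equalityI subsetI)
      fix A assume "A \<in> V // ?R'"
      then obtain x where x: "x \<in> V" "A = ?R' `` {x}" by (auto elim: quotientE)
      show "A \<in> insert M (V // ?R - {?u, ?v})"
      proof (cases "x \<in> M")
        case False
        have "x \<in> ?R `` {x}" using x by (auto intro: reach_refl)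
        then have "?R `` {x} \<noteq> ?u" "?R `` {x} \<noteq> ?v" using False by (auto simp: M_def)
        then show ?thesis using False x cls by (auto intro: quotientI)
      qed (use x cls in auto)
    next
      fix A assume A: "A \<in> insert M (V // ?R - {?u, ?v})"
      have uM: "u \<in> M" using uu by (auto simp: M_def)
      show "A \<in> V // ?R'"
      proof (cases "A = M")
        case True
        then show ?thesis using cls[of u] uM uv by (metis quotientI)
      next
        case False
        then have A: "A \<in> V // ?R" "A \<noteq> ?u" "A \<noteq> ?v" using A by auto
        then obtain x where x: "x \<in> V" "A = ?R `` {x}" by (auto elim: quotientE)
        have "x \<notin> M"
          using A x eq uv by (auto simp: M_def dest: equiv_class_eq)
        then show ?thesis using cls[of x] x by (metis quotientI)
      qed
    qed
    moreover have "M \<notin> V // ?R - {?u, ?v}"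
    proof
      assume "M \<in> V // ?R - {?u, ?v}"
      then have "M \<in> V // ?R" "M \<noteq> ?u" by auto
      then have "M \<inter> ?u = {}" using in_q eq quotient_disj by blast
      then show False using uu by (auto simp: M_def)
    qed
    moreover have "finite (V // ?R)" by (rule finite_quotient_reach[OF V])
    ultimately have "num_comp V (insert {u, v} F) = Suc (card (V // ?R - {?u, ?v}))"
      by (simp add: num_comp_def)
    also have "card (V // ?R - {?u, ?v}) = card (V // ?R) - 2"
      using in_q ne by (subst card_Diff_subset) auto
    also have "card (V // ?R) \<ge> 2"
      using card_mono[OF \<open>finite (V // ?R)\<close>, of "{?u, ?v}"] in_q ne by auto
    ultimately show ?thesis using False by (simp add: num_comp_def)
  qed
qed

text \<open>
  An edge that merges two components of the larger graph also merges two components of the smaller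
  one, so adding \<open>D\<close> lowers the number of components of the smaller graph at least as much.
\<close>

lemma num_comp_diminishing:
  assumes V: "finite V" and X: "X \<subseteq> Y" and Y: "Y \<subseteq> Pow V"
    and D: "finite D" "\<forall>e\<in>D. e \<subseteq> V \<and> card e = 2"
  shows "num_comp V X + num_comp V (Y \<union> D) \<ge> num_comp V Y + num_comp V (X \<union> D)"
  using D
proof (induction D rule: finite_induct)
  case (insert e D)
  have sub: "X \<union> D \<subseteq> Pow V" "Y \<union> D \<subseteq> Pow V" using X Y insert.prems by auto
  obtain u v where uv: "e = {u, v}" "u \<in> V" "v \<in> V"
    using insert.prems by (auto simp: card_2_iff)
  have "(u, v) \<in> reach V (X \<union> D) \<longrightarrow> (u, v) \<in> reach V (Y \<union> D)"
    using reach_mono[of "X \<union> D" "Y \<union> D" V] X by auto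
  then show ?case
    using insert.IH insert.prems num_comp_insert[OF V sub(1) uv(2,3)] num_comp_insert[OF V sub(2) uv(2,3)]
    by (auto simp: uv(1) split: if_splits)
qed simp

text \<open>
  Up to sign and a constant, \<open>num_comp V\<close> is the rank function of the graphic matroid.
\<close>

lemma num_comp_submodular:
  assumes V: "finite V" and G: "finite (X \<union> Y)" "\<forall>e\<in>X \<union> Y. e \<subseteq> V \<and> card e = 2"
  shows "num_comp V X + num_comp V Y \<le> num_comp V (X \<union> Y) + num_comp V (X \<inter> Y)"
proof -
  have "num_comp V (X \<inter> Y) + num_comp V (Y \<union> (X - Y)) \<ge> num_comp V Y + num_comp V (X \<inter> Y \<union> (X - Y))"
    using G by (intro num_comp_diminishing[OF V]) auto
  moreover have "X \<inter> Y \<union> (X - Y) = X" "Y \<union> (X - Y) = X \<union> Y" by auto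
  ultimately show ?thesis by simp
qed

lemma num_comp_antimono:
  assumes V: "finite V" and "X \<subseteq> Y" and G: "finite Y" "\<forall>e\<in>Y. e \<subseteq> V \<and> card e = 2"
  shows "num_comp V Y \<le> num_comp V X"
proof -
  have "num_comp V (X \<union> D) \<le> num_comp V X" if "finite D" "D \<subseteq> Y" for D
    using that
  proof (induction D rule: finite_induct)
    case (insert e D)
    have sub: "X \<union> D \<subseteq> Pow V" using assms insert.prems by auto
    obtain u v where uv: "e = {u, v}" "u \<in> V" "v \<in> V"
      using insert.prems G(2) by (auto simp: card_2_iff)
    show ?case
      using insert num_comp_insert[OF V sub uv(2,3)] by (simp add: uv(1) split: if_splits)
  qed simp
  from this[OF G(1)] show ?thesis using \<open>X \<subseteq> Y\<close> by (simp add: Un_absorb1)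
qed

section \<open>Rainbow spanning trees\<close>

lemma num_comp_le_1_connected:
  assumes "finite V" "V \<noteq> {}" "num_comp V F \<le> 1"
  shows "connected_graph V F"
proof -
  have "(u, v) \<in> reach V F" if "u \<in> V" "v \<in> V" for u v
  proof -
    have "reach V F `` {u} = reach V F `` {v}"
      using assms(3) that finite_quotient_reach[OF assms(1), of F] quotientI[of _ V "reach V F"]
      by (auto simp: num_comp_def card_le_Suc0_iff_eq)
    then show ?thesis using that equiv_reach by (metis eq_equiv_class)
  qed
  then show ?thesis using assms(2) by (auto simp: connected_graph_def reach_def)
qed

lemma connected_graph_Diff_edge:
  assumes conn: "connected_graph V F"
    and uv: "(u, v) \<in> {(x, y). {x, y} \<in> F - {{u, v}}}\<^sup>*"
  shows "connected_graph V (F - {{u, v}})"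
proof -
  let ?A = "{(x, y). {x, y} \<in> F - {{u, v}}}"
  have "sym ?A" by (auto simp: sym_def insert_commute)
  then have vu: "(v, u) \<in> ?A\<^sup>*" using uv by (meson symD sym_rtrancl)
  have "(x, y) \<in> ?A\<^sup>*" if "(x, y) \<in> {(x, y). {x, y} \<in> F}\<^sup>*" for x y
    using that
  proof (induction rule: rtrancl_induct)
    case (step y z)
    show ?case
    proof (cases "{y, z} = {u, v}")
      case True
      then have "(y, z) \<in> ?A\<^sup>*" using uv vu by (auto simp: doubleton_eq_iff)
      then show ?thesis using step.IH by (rule rtrancl_trans[rotated])
    next
      case False
      then have "(y, z) \<in> ?A" using step.hyps by auto
      then show ?thesis using step.IH by (rule rtrancl_into_rtrancl[rotated])
    qed
  qed simp
  then show ?thesis using conn unfolding connected_graph_def by blast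
qed

text \<open>
  The rest of the cycle is a detour around its first edge.
\<close>

lemma cycle_edge_redundant:
  assumes "is_cycle F p"
  shows "{p ! 0, p ! 1} \<in> F" "(p ! 1, p ! 0) \<in> {(x, y). {x, y} \<in> F - {{p ! 0, p ! 1}}}\<^sup>*"
proof -
  let ?A = "{(x, y). {x, y} \<in> F - {{p ! 0, p ! 1}}}"
  have len: "length p \<ge> 3" and dist: "distinct p"
    and edge: "\<And>i. i < length p \<Longrightarrow> {p ! i, p ! (Suc i mod length p)} \<in> F"
    using assms by (auto simp: is_cycle_def)
  show "{p ! 0, p ! 1} \<in> F" using edge[of 0] len by fastforce
  have step: "(p ! i, p ! (Suc i mod length p)) \<in> ?A" if "i \<ge> 1" "i < length p" for i
  proof -
    have "{p ! i, p ! (Suc i mod length p)} \<noteq> {p ! 0, p ! 1}"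
    proof
      assume "{p ! i, p ! (Suc i mod length p)} = {p ! 0, p ! 1}"
      then have "p ! i = p ! 0 \<or> p ! i = p ! 1 \<and> p ! (Suc i mod length p) = p ! 0"
        by (auto simp: doubleton_eq_iff)
      moreover have "p ! i \<noteq> p ! 0"
        using dist that len by (subst nth_eq_iff_index_eq) auto
      ultimately have e: "p ! i = p ! 1" "p ! (Suc i mod length p) = p ! 0" by auto
      then have "i = 1" using dist that len by (subst (asm) nth_eq_iff_index_eq) auto
      then have "p ! 2 = p ! 0" using e len by (simp add: numeral_2_eq_2)
      then show False using dist len by (subst (asm) nth_eq_iff_index_eq) auto
    qed
    then show ?thesis using edge[of i] that by auto
  qed
  have walk: "(p ! 1, p ! i) \<in> ?A\<^sup>*" if "i \<ge> 1" "i < length p" for i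
    using that
  proof (induction i rule: nat_induct_at_least)
    case (Suc i)
    then show ?case using step[of i] by (auto intro: rtrancl_into_rtrancl)
  qed simp
  have "(p ! 1, p ! (length p - 1)) \<in> ?A\<^sup>*" using walk[of "length p - 1"] len by simp
  moreover have "(p ! (length p - 1), p ! 0) \<in> ?A" proof -
    have "Suc (length p - 1) = length p" using len by simp
    then have "Suc (length p - 1) mod length p = 0" "1 \<le> length p - 1" "length p - 1 < length p"
      using len by auto
    then show ?thesis using step[of "length p - 1"] by metis
  qed
  ultimately show "(p ! 1, p ! 0) \<in> ?A\<^sup>*" by (rule rtrancl_into_rtrancl)
qed

text \<open>
  A minimal connected set of edges has no cycle, because an edge of a cycle could be removed.
\<close>

lemma connected_contains_tree:
  assumes "simple_graph V F" "finite F" "connected_graph V F"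
  obtains T where "T \<subseteq> F" "is_tree V T"
proof -
  obtain T where T: "T \<subseteq> F" "connected_graph V T"
    and min: "\<And>T'. T' \<subset> T \<Longrightarrow> \<not> connected_graph V T'"
  proof -
    let ?S = "{T. T \<subseteq> F \<and> connected_graph V T}"
    have "finite ?S" "?S \<noteq> {}" using assms by auto
    then obtain T where "T \<in> ?S" "\<forall>T'\<in>?S. T' \<subseteq> T \<longrightarrow> T = T'"
      by (metis (no_types, lifting) finite_has_minimal)
    then show ?thesis using that[of T] by blast
  qed
  \<comment> \<open>The removed edge is written with its ends swapped, so that the detour leads from its first to its second end.\<close>
  have "\<not> is_cycle T p" for p
  proof
    assume "is_cycle T p"
    from cycle_edge_redundant[OF this]
    have "{p ! 1, p ! 0} \<in> T"
      "(p ! 1, p ! 0) \<in> {(x, y). {x, y} \<in> T - {{p ! 1, p ! 0}}}\<^sup>*"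
      by (simp_all add: insert_commute)
    then show False using connected_graph_Diff_edge[OF T(2)] min[of "T - {{p ! 1, p ! 0}}"] by blast
  qed
  then have "is_tree V T" using T assms(1) by (auto simp: is_tree_def simple_graph_def)
  then show ?thesis using T that by blast
qed

text \<open>
  Rado's exchange argument. Take \<open>F\<close> minimal with the property assumed of \<open>E\<close>. If two of its edges had
  the same colour, removing either of them would violate the condition for some colour sets \<open>K\<close> and
  \<open>L\<close>. By submodularity the violations for \<open>K\<close> and \<open>L\<close> produce one for \<open>K \<union> L\<close> or for \<open>K \<inter> L\<close>
  without the common colour, in \<open>F\<close> itself. Taking \<open>K = Q\<close> in the condition shows that the minimal
  \<open>F\<close> is connected.
\<close>

lemma rado_rainbow_connected:
  fixes \<phi> :: "'v set \<Rightarrow> 'c"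
  assumes V: "finite V" and E: "finite E" "\<forall>e\<in>E. e \<subseteq> V \<and> card e = 2"
    and Q: "finite Q"
    and cond: "\<And>K. K \<subseteq> Q \<Longrightarrow> num_comp V {e \<in> E. \<phi> e \<in> K} \<le> 1 + card (Q - K)"
  obtains F where "F \<subseteq> E" "inj_on \<phi> F" "num_comp V F \<le> 1"
proof -
  define ok where "ok F \<longleftrightarrow> (\<forall>K\<subseteq>Q. num_comp V {e \<in> F. \<phi> e \<in> K} \<le> 1 + card (Q - K))" for F
  obtain F where F: "F \<subseteq> E" "ok F" and min: "\<And>F'. F' \<subset> F \<Longrightarrow> \<not> ok F'"
  proof -
    let ?S = "{F. F \<subseteq> E \<and> ok F}"
    have "finite ?S" "?S \<noteq> {}" using E cond by (auto simp: ok_def)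
    then obtain F where "F \<in> ?S" "\<forall>F'\<in>?S. F' \<subseteq> F \<longrightarrow> F = F'"
      by (metis (no_types, lifting) finite_has_minimal)
    then show ?thesis using that[of F] by blast
  qed
  have violated: "\<exists>K\<subseteq>Q. \<phi> x \<in> K \<and> num_comp V {e \<in> F - {x}. \<phi> e \<in> K} \<ge> 2 + card (Q - K)"
    if "x \<in> F" for x
  proof -
    have "\<not> ok (F - {x})" using min[of "F - {x}"] that by blast
    then obtain K where K: "K \<subseteq> Q" "num_comp V {e \<in> F - {x}. \<phi> e \<in> K} > 1 + card (Q - K)"
      unfolding ok_def by (auto simp: not_le)
    have "\<phi> x \<in> K"
    proof (rule ccontr)
      assume "\<phi> x \<notin> K"
      then have "{e \<in> F - {x}. \<phi> e \<in> K} = {e \<in> F. \<phi> e \<in> K}" by auto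
      then show False using K F(2) unfolding ok_def by (metis not_le)
    qed
    then show ?thesis using K by (intro exI[of _ K]) auto
  qed
  have okD: "num_comp V {e \<in> F. \<phi> e \<in> K} \<le> 1 + card (Q - K)" if "K \<subseteq> Q" for K
    using F(2) that by (simp add: ok_def)
  have "inj_on \<phi> F"
  proof (rule inj_onI, rule ccontr)
    fix x y assume xy: "x \<in> F" "y \<in> F" "\<phi> x = \<phi> y" "x \<noteq> y"
    let ?r = "\<lambda>F K. {e \<in> F. \<phi> e \<in> K}"
    from violated[OF xy(1)] obtain K
      where K: "K \<subseteq> Q" "\<phi> x \<in> K" "num_comp V (?r (F - {x}) K) \<ge> 2 + card (Q - K)"
      by blast
    from violated[OF xy(2)] xy(3) obtain L
      where L: "L \<subseteq> Q" "\<phi> x \<in> L" "num_comp V (?r (F - {y}) L) \<ge> 2 + card (Q - L)"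
      by auto
    let ?I = "K \<inter> L - {\<phi> x}"
    have edges: "\<forall>e\<in>?r (F - {x}) K \<union> ?r (F - {y}) L. e \<subseteq> V \<and> card e = 2"
      "finite (?r (F - {x}) K \<union> ?r (F - {y}) L)"
      using F(1) E finite_subset[of F E] by auto
    have "?r (F - {x}) K \<union> ?r (F - {y}) L = ?r F (K \<union> L)"
      using xy K(2) L(2) by auto
    then have "num_comp V (?r (F - {x}) K \<union> ?r (F - {y}) L) = num_comp V (?r F (K \<union> L))"
      by (rule arg_cong)
    moreover have "num_comp V (?r (F - {x}) K \<inter> ?r (F - {y}) L) \<le> num_comp V (?r F ?I)"
      using edges xy by (intro num_comp_antimono[OF V]) auto
    moreover have "num_comp V (?r F (K \<union> L)) \<le> 1 + card (Q - (K \<union> L))"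
      "num_comp V (?r F ?I) \<le> 1 + card (Q - ?I)"
      by (rule okD, use K(1) L(1) in blast)+
    moreover have "card (Q - (K \<union> L)) + card (Q - ?I) = card (Q - K) + card (Q - L) + 1"
    proof -
      \<comment> \<open>The common colour is counted once more on the left: this is the gain that yields the contradiction.\<close>
      have "Q - ?I = insert (\<phi> x) ((Q - K) \<union> (Q - L))" using K L by auto
      moreover have "\<phi> x \<notin> (Q - K) \<union> (Q - L)" using K L by auto
      ultimately have "card (Q - ?I) = Suc (card ((Q - K) \<union> (Q - L)))" using Q by simp
      moreover have "Q - (K \<union> L) = (Q - K) \<inter> (Q - L)" by auto
      ultimately show ?thesis using card_Un_Int[of "Q - K" "Q - L"] Q by simp
    qed
    ultimately show False
      using num_comp_submodular[OF V edges(2,1)] K(3) L(3) by linarith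
  qed
  moreover have "num_comp V {e \<in> F. \<phi> e \<in> Q} \<le> 1" using okD[of Q] by simp
  then have "num_comp V F \<le> 1"
    using num_comp_antimono[OF V, of "{e \<in> F. \<phi> e \<in> Q}" F] F(1) E finite_subset[of F E] by fastforce
  ultimately show ?thesis using that F(1) by blast
qed

lemma rainbow_spanning_tree_exists:
  fixes \<phi> :: "'v set \<Rightarrow> 'c"
  assumes "simple_graph V E" "V \<noteq> {}"
    and "\<And>K. K \<subseteq> \<phi> ` E \<Longrightarrow> num_comp V {e \<in> E. \<phi> e \<in> K} \<le> 1 + card (\<phi> ` E - K)"
  obtains T where "spanning_tree V E T" "rainbow \<phi> T"
proof -
  have V: "finite V" and E: "\<forall>e\<in>E. e \<subseteq> V \<and> card e = 2" using assms(1) by (auto simp: simple_graph_def)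
  have "finite E" using V E by (intro finite_subset[of E "Pow V"]) auto
  then obtain F where F: "F \<subseteq> E" "inj_on \<phi> F" "num_comp V F \<le> 1"
    using rado_rainbow_connected[OF V _ E, of "\<phi> ` E" \<phi>] assms(3) by auto
  have "simple_graph V F" "finite F"
    using F(1) assms(1) \<open>finite E\<close> by (auto simp: simple_graph_def intro: finite_subset)
  then obtain T where "T \<subseteq> F" "is_tree V T"
    using connected_contains_tree num_comp_le_1_connected[OF V assms(2) F(3)] by metis
  then show ?thesis
    using that[of T] F by (auto simp: spanning_tree_def rainbow_def intro: inj_on_subset)
qed

section \<open>Two eigenvectors bound the second smallest eigenvalue\<close>

text \<open>
  For \<open>e = f\<close> this says that the geometric multiplicity of an eigenvalue does not exceed its algebraic
  multiplicity, which is what disconnected graphs need. The proof deflates: in an orthogonal basis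
  that starts with \<open>v\<close>, the matrix is block triangular with upper left entry \<open>e\<close>, and \<open>w\<close> induces an
  eigenvector of the lower right block.
\<close>

lemma char_poly_two_eigenvectors:
  fixes A :: "real mat"
  assumes A: "A \<in> carrier_mat n n"
    and v: "v \<in> carrier_vec n" "v \<noteq> 0\<^sub>v n" "A *\<^sub>v v = e \<cdot>\<^sub>v v"
    and w: "w \<in> carrier_vec n" "A *\<^sub>v w = f \<cdot>\<^sub>v w" "\<And>c. w \<noteq> c \<cdot>\<^sub>v v"
  shows "[:-e, 1:] * [:-f, 1:] dvd char_poly A"
proof -
  have n: "n \<noteq> 0" using v by auto
  interpret cof_vec_space n "TYPE(real)" .
  define b where "b = basis_completion v"
  \<comment> \<open>The columns of \<open>W\<close> are an orthogonal basis with first member \<open>v\<close>.\<close>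
  define ws where "ws = gram_schmidt n b"
  define W where "W = mat_of_cols n ws"
  define W' where "W' = corthogonal_inv W"
  define A' where "A' = W' * A * W"
  from basis_completion[OF v(1,2), folded b_def]
  have dist_b: "distinct b" and indep: "\<not> lin_dep (set b)" and b: "set b \<subseteq> carrier_vec n"
    and hdb: "hd b = v" and len_b: "length b = n" by auto
  from hdb len_b n obtain vs where bv: "b = v # vs" by (cases b) auto
  from gram_schmidt_result[OF b dist_b indep refl, folded ws_def]
  have ws: "set ws \<subseteq> carrier_vec n" "corthogonal ws" "length ws = n"
    by (auto simp: len_b)
  from gram_schmidt_hd[OF v(1), of vs, folded bv] have hdws: "hd ws = v" unfolding ws_def .
  have orth_W: "corthogonal_mat W" using orthogonal_mat_of_cols ws unfolding W_def .
  have W: "W \<in> carrier_mat n n"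
    using ws unfolding W_def using mat_of_cols_carrier(1)[of n ws] by auto
  have W': "W' \<in> carrier_mat n n" unfolding W'_def corthogonal_inv_def using W
    by (auto simp: mat_of_rows_def)
  have W'W: "W' * W = 1\<^sub>m n"
    using corthogonal_inv_result[OF orth_W] W W' unfolding W'_def inverts_mat_def by auto
  have WW': "W * W' = 1\<^sub>m n" by (rule mat_mult_left_right_inverse[OF W' W W'W])
  have A': "A' \<in> carrier_mat n n" using W W' A unfolding A'_def by auto
  have "similar_mat_wit A' A W' W"
    by (rule similar_mat_witI[of _ _ n]) (use W W' A A' W'W WW' in \<open>auto simp: A'_def\<close>)
  then have cp: "char_poly A = char_poly A'"
    by (metis char_poly_similar similar_mat_def)
  have col0: "col A' 0 = vec n (\<lambda>i. if i = 0 then e else 0)"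
    unfolding A'_def W'_def W_def by (rule corthogonal_col_ev_0[OF A v n hdws ws])
  have A'0: "A' $$ (i, 0) = (if i = 0 then e else 0)" if "i < n" for i
    using arg_cong[OF col0, of "\<lambda>v. v $ i"] that n A' by auto
  define m where "m = n - 1"
  have nm: "n = Suc m" using n by (simp add: m_def)
  define A1 A2 A3 where "A1 = mat 1 1 (\<lambda>_. e)" and "A2 = mat 1 m (\<lambda>(i, j). A' $$ (i, Suc j))"
    and "A3 = mat m m (\<lambda>(i, j). A' $$ (Suc i, Suc j))"
  have car: "A1 \<in> carrier_mat 1 1" "A2 \<in> carrier_mat 1 m" "A3 \<in> carrier_mat m m"
    by (auto simp: A1_def A2_def A3_def)
  have "A' = four_block_mat A1 A2 (0\<^sub>m m 1) A3"
    by (rule eq_matI) (use A' A'0 nm in \<open>auto simp: A1_def A2_def A3_def\<close>)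
  then have "char_poly A' = char_poly A1 * char_poly A3"
    using char_poly_four_block_zeros_col[OF car] by simp
  moreover have "char_poly A1 = [:-e, 1:]"
    by (simp add: A1_def char_poly_defs det_def sign_def)
  moreover have "[:-f, 1:] dvd char_poly A3"
  proof -
    define z where "z = W' *\<^sub>v w"
    have z: "z \<in> carrier_vec n" using W' w by (auto simp: z_def)
    have Wz: "W *\<^sub>v z = w"
      using W W' w WW' by (simp add: z_def flip: assoc_mult_mat_vec)
    have A'z: "A' *\<^sub>v z = f \<cdot>\<^sub>v z"
    proof -
      have "A' *\<^sub>v z = W' *\<^sub>v (A *\<^sub>v (W *\<^sub>v z))"
        using A W W' z unfolding A'_def by (simp add: assoc_mult_mat_vec[of _ n n _ n] mult_carrier_mat[of _ n n _ n])
      also have "\<dots> = f \<cdot>\<^sub>v z" unfolding Wz using W' w by (simp add: z_def mult_mat_vec[of _ n n])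
      finally show ?thesis .
    qed
    define y where "y = vec m (\<lambda>i. z $ Suc i)"
    have y: "y \<in> carrier_vec m" by (simp add: y_def)
    have "A3 *\<^sub>v y = f \<cdot>\<^sub>v y"
    proof (rule eq_vecI)
      fix i assume "i < dim_vec (f \<cdot>\<^sub>v y)"
      then have i: "i < m" by (simp add: y_def)
      have "(A3 *\<^sub>v y) $ i = (\<Sum>j = 0..<m. A' $$ (Suc i, Suc j) * z $ Suc j)"
        using i car A' by (simp add: scalar_prod_def A3_def y_def)
      also have "\<dots> = (\<Sum>j = 0..<n. A' $$ (Suc i, j) * z $ j)"
        using A'0[of "Suc i"] i nm by (simp add: sum.atLeast0_lessThan_Suc_shift del: sum.op_ivl_Suc)
      also have "\<dots> = (A' *\<^sub>v z) $ Suc i"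
        using i nm A' z by (simp add: scalar_prod_def)
      also have "\<dots> = (f \<cdot>\<^sub>v y) $ i" using i nm z by (simp add: A'z y_def)
      finally show "(A3 *\<^sub>v y) $ i = (f \<cdot>\<^sub>v y) $ i" .
    qed (use car in \<open>auto simp: y_def\<close>)
    moreover have "y \<noteq> 0\<^sub>v m"
    proof
      assume y0: "y = 0\<^sub>v m"
      have "z $ i = (if i = 0 then z $ 0 else 0)" if "i < n" for i
        using arg_cong[OF y0, of "\<lambda>v. v $ (i - 1)"] that nm by (auto simp: y_def)
      then have "w = z $ 0 \<cdot>\<^sub>v v"
      proof -
        assume zi: "\<And>i. i < n \<Longrightarrow> z $ i = (if i = 0 then z $ 0 else 0)"
        have colW: "col W 0 = v"
          using hdws ws n unfolding W_def by (cases ws) auto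
        show ?thesis
        proof (rule eq_vecI)
          fix i assume "i < dim_vec (z $ 0 \<cdot>\<^sub>v v)"
          then have i: "i < n" using v by simp
          have "w $ i = (\<Sum>j = 0..<n. W $$ (i, j) * z $ j)"
            using i W z by (simp add: scalar_prod_def flip: Wz)
          also have "\<dots> = (\<Sum>j = 0..<n. if j = 0 then W $$ (i, 0) * z $ 0 else 0)"
          proof (rule sum.cong)
            fix j assume "j \<in> {0..<n}"
            then show "W $$ (i, j) * z $ j = (if j = 0 then W $$ (i, 0) * z $ 0 else 0)"
              using zi[of j] by (cases "j = 0") simp_all
          qed simp
          also have "\<dots> = W $$ (i, 0) * z $ 0" using n by simp
          also have "W $$ (i, 0) = v $ i" using colW i n W by (metis carrier_matD index_col not_gr0)
          finally show "w $ i = (z $ 0 \<cdot>\<^sub>v v) $ i" using i v by simp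
        qed (use v w in auto)
      qed
      then show False using w(3) by blast
    qed
    ultimately have "eigenvalue A3 f"
      using car y unfolding eigenvalue_def eigenvector_def by auto
    then have "poly (char_poly A3) f = 0" using eigenvalue_root_char_poly[OF car(3)] by simp
    then show ?thesis by (simp add: poly_eq_0_iff_dvd)
  qed
  ultimately show ?thesis unfolding cp by (metis dvd_refl mult_dvd_mono)
qed

text \<open>
  Both roots are at most \<open>f\<close>, so the sorted list has at least two entries up to \<open>f\<close>. This also shows
  that index 1 is within the list.
\<close>

lemma sorted_eigenvalue_1_le:
  fixes A :: "real mat"
  assumes A: "A \<in> carrier_mat n n" and dvd: "[:-e, 1:] * [:-f, 1:] dvd char_poly A" and "e \<le> f"
  shows "sorted_eigenvalues A ! 1 \<le> f"
proof -
  let ?p = "char_poly A" and ?xs = "sorted_eigenvalues A"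
  have p0: "?p \<noteq> 0" using degree_monic_char_poly[OF A] by auto
  obtain q where q: "?p = [:-e, 1:] * ([:-f, 1:] * q)" using dvd by (metis dvdE mult.assoc)
  have "proots ?p = proots [:-e, 1:] + (proots [:-f, 1:] + proots q)"
    using p0 unfolding q by (subst proots_mult; (subst proots_mult)?) auto
  then have sub: "{#e, f#} \<subseteq># proots ?p"
    by simp
  have mset: "mset ?xs = proots ?p" by (simp add: sorted_eigenvalues_def)
  have "sorted ?xs" by (simp add: sorted_eigenvalues_def)
  have len: "length ?xs \<ge> 2" using size_mset_mono[OF sub] by (simp flip: mset)
  then obtain x y zs where xs: "?xs = x # y # zs"
    by (cases ?xs; cases "tl ?xs") auto
  show ?thesis
  proof (rule ccontr)
    assume "\<not> ?thesis"
    then have "y > f" using xs by simp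
    then have "filter_mset (\<lambda>a. a \<le> f) (mset (y # zs)) = {#}"
      using \<open>sorted ?xs\<close> by (auto simp: xs filter_mset_eq_conv)
    then have "filter_mset (\<lambda>a. a \<le> f) (proots ?p) \<subseteq># {#x#}"
      by (simp flip: mset add: xs)
    moreover have "filter_mset (\<lambda>a. a \<le> f) {#e, f#} \<subseteq># filter_mset (\<lambda>a. a \<le> f) (proots ?p)"
      using sub by (rule multiset_filter_mono)
    ultimately have "size (filter_mset (\<lambda>a. a \<le> f) {#e, f#}) \<le> size {#x#}"
      by (meson size_mset_mono order_trans)
    then show False using \<open>e \<le> f\<close> by simp
  qed
qed

section \<open>Minimizing a quadratic form on a hyperplane\<close>

text \<open>
  The first-order condition at a minimum, in the form in which the Rayleigh quotient needs it.
\<close>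

lemma quadratic_nonneg_linear_coeff_zero:
  fixes a b :: real
  assumes "\<And>t. 0 \<le> 2 * t * a + t\<^sup>2 * b"
  shows "a = 0"
proof (rule ccontr)
  assume "a \<noteq> 0"
  \<comment> \<open>At \<open>t = - a / d\<close> the linear term outweighs the quadratic one as soon as \<open>b < 2 d\<close>.\<close>
  define d where "d = \<bar>b\<bar> + 1"
  have d: "d > 0" "b < 2 * d" by (auto simp: d_def)
  have "0 \<le> 2 * (- a / d) * a + (- a / d)\<^sup>2 * b" by (rule assms)
  also have "\<dots> = (a\<^sup>2 / d\<^sup>2) * (b - 2 * d)"
    using d by (simp add: field_simps power2_eq_square)
  also have "\<dots> < 0"
    using d \<open>a \<noteq> 0\<close> by (intro mult_pos_neg) auto
  finally show False by simp
qed

text \<open>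
  Vectors indexed by \<open>V\<close> are functions on the whole type. Demanding that they vanish outside \<open>V\<close> makes
  the unit sphere a closed subset of a product of compact sets, so that Tychonoff's theorem applies.
\<close>

lemma minimizer_on_orthogonal_sphere:
  fixes Q :: "('v \<Rightarrow> real) \<Rightarrow> real" and p :: "'v \<Rightarrow> real"
  assumes V: "finite V" "card V \<ge> 2" and cont: "continuous_on UNIV Q"
  obtains x where "(\<Sum>v\<in>V. x v * p v) = 0" "(\<Sum>v\<in>V. (x v)\<^sup>2) = 1"
    "\<forall>y. (\<forall>v. v \<notin> V \<longrightarrow> y v = 0) \<longrightarrow> (\<Sum>v\<in>V. y v * p v) = 0 \<longrightarrow> (\<Sum>v\<in>V. (y v)\<^sup>2) = 1 \<longrightarrow> Q x \<le> Q y"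
proof -
  define B :: "('v \<Rightarrow> real) set" where "B = PiE UNIV (\<lambda>v. if v \<in> V then {-1..1} else {0})"
  define K where "K = B \<inter> ({x. (\<Sum>v\<in>V. x v * p v) = 0} \<inter> {x. (\<Sum>v\<in>V. (x v)\<^sup>2) = 1})"
  have "compactin (product_topology (\<lambda>_. euclidean) UNIV) B"
    unfolding B_def by (subst compactin_PiE) (auto simp: compactin_euclidean_iff)
  then have "compact B" by (simp add: euclidean_product_topology compactin_euclidean_iff)
  moreover have "closed {x. (\<Sum>v\<in>V. x v * p v) = 0}" "closed {x. (\<Sum>v\<in>V. (x v)\<^sup>2) = (1::real)}"
    by (intro closed_Collect_eq continuous_intros continuous_on_product_coordinates)+
  ultimately have "compact K" unfolding K_def by (intro compact_Int_closed closed_Int)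
  have KI: "y \<in> K" if "\<And>v. v \<notin> V \<Longrightarrow> y v = 0" "(\<Sum>v\<in>V. y v * p v) = 0" "(\<Sum>v\<in>V. (y v)\<^sup>2) = 1" for y
  proof -
    have "\<bar>y v\<bar> \<le> 1" if "v \<in> V" for v
      using member_le_sum[of v V "\<lambda>v. (y v)\<^sup>2"] that V \<open>(\<Sum>v\<in>V. (y v)\<^sup>2) = 1\<close>
      by (simp add: abs_square_le_1)
    then show ?thesis using that by (auto simp: K_def B_def abs_le_iff minus_le_iff)
  qed
  obtain a b where ab: "a \<in> V" "b \<in> V" "a \<noteq> b"
    using V by (metis One_nat_def card_le_Suc0_iff_eq not_less_eq_eq numeral_2_eq_2)
  \<comment> \<open>A combination of two unit vectors that is orthogonal to \<open>p\<close> shows that \<open>K\<close> is nonempty.\<close>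
  define c d where "c = (if p a = 0 \<and> p b = 0 then 1 else p b)" and "d = (if p a = 0 \<and> p b = 0 then 0 else - p a)"
  define y where "y v = (if v = a then c else if v = b then d else 0) / sqrt (c\<^sup>2 + d\<^sup>2)" for v
  have cd: "c\<^sup>2 + d\<^sup>2 > 0" by (auto simp: c_def d_def sum_power2_gt_zero_iff)
  have split: "(\<Sum>v\<in>V. g v) = g a + g b" if "\<And>v. v \<noteq> a \<Longrightarrow> v \<noteq> b \<Longrightarrow> g v = 0" for g :: "'v \<Rightarrow> real"
  proof -
    have "(\<Sum>v\<in>V. g v) = (\<Sum>v\<in>{a, b}. g v)"
      using ab V that by (intro sum.mono_neutral_right) auto
    then show ?thesis using ab by simp
  qed
  have "y \<in> K"
  proof (rule KI)
    show "(\<Sum>v\<in>V. y v * p v) = 0"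
      using ab by (subst split) (auto simp: y_def c_def d_def)
    show "(\<Sum>v\<in>V. (y v)\<^sup>2) = 1"
      using ab cd by (subst split) (auto simp: y_def power_divide simp flip: add_divide_distrib)
  qed (use ab in \<open>auto simp: y_def\<close>)
  then obtain x where "x \<in> K" "\<And>y. y \<in> K \<Longrightarrow> Q x \<le> Q y"
    using continuous_attains_inf[OF \<open>compact K\<close>, of Q] cont by (auto intro: continuous_on_subset)
  then show ?thesis using that[of x] KI by (auto simp: K_def)
qed

text \<open>
  The spectral theorem is only needed for the smallest eigenvalue on the orthogonal complement of a
  null vector \<open>p\<close>: a minimizer of the quadratic form there is an eigenvector. The first-order condition
  gives the eigenvalue equation tested against vectors orthogonal to \<open>p\<close>; tested against \<open>p\<close> both
  sides vanish.
\<close>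

lemma rayleigh_minimizer:
  fixes M :: "'v \<Rightarrow> 'v \<Rightarrow> real"
  assumes V: "finite V" "card V \<ge> 2"
    and sym: "\<And>u v. M u v = M v u"
    and null: "\<And>u. u \<in> V \<Longrightarrow> (\<Sum>v\<in>V. M u v * p v) = 0"
    and p: "(\<Sum>v\<in>V. (p v)\<^sup>2) \<noteq> 0"
  obtains \<mu> x where "(\<Sum>v\<in>V. x v * p v) = 0" "(\<Sum>v\<in>V. (x v)\<^sup>2) = 1"
    "\<forall>u\<in>V. (\<Sum>v\<in>V. M u v * x v) = \<mu> * x u"
    "\<forall>y. (\<Sum>v\<in>V. y v * p v) = 0 \<longrightarrow> \<mu> * (\<Sum>v\<in>V. (y v)\<^sup>2) \<le> (\<Sum>u\<in>V. \<Sum>v\<in>V. y u * M u v * y v)"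
proof -
  define ip where "ip x y = (\<Sum>v\<in>V. x v * y v)" for x y :: "'v \<Rightarrow> real"
  define B where "B x y = (\<Sum>u\<in>V. \<Sum>v\<in>V. x u * M u v * y v)" for x y :: "'v \<Rightarrow> real"
  have ip_sq: "ip x x = (\<Sum>v\<in>V. (x v)\<^sup>2)" for x by (simp add: ip_def power2_eq_square)
  have ip_comm: "ip x y = ip y x" for x y by (simp add: ip_def mult.commute)
  have B_comm: "B x y = B y x" for x y
  proof -
    have "B x y = (\<Sum>v\<in>V. \<Sum>u\<in>V. x u * M u v * y v)" unfolding B_def by (rule sum.swap)
    also have "\<dots> = B y x" unfolding B_def by (intro sum.cong) (auto simp: sym mult_ac)
    finally show ?thesis .
  qed
  have ip_lin: "ip x (\<lambda>v. y v + t * z v) = ip x y + t * ip x z" for x y z t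
    by (simp add: ip_def distrib_left sum.distrib sum_distrib_left mult_ac)
  have B_lin: "B x (\<lambda>v. y v + t * z v) = B x y + t * B x z" for x y z t
    by (simp add: B_def distrib_left sum.distrib sum_distrib_left mult_ac)
  have cont: "continuous_on UNIV (\<lambda>x. B x x)"
    unfolding B_def by (intro continuous_intros continuous_on_product_coordinates)
  obtain x where "(\<Sum>v\<in>V. x v * p v) = 0" "(\<Sum>v\<in>V. (x v)\<^sup>2) = 1"
    and "\<forall>y. (\<forall>v. v \<notin> V \<longrightarrow> y v = 0) \<longrightarrow> (\<Sum>v\<in>V. y v * p v) = 0 \<longrightarrow>
      (\<Sum>v\<in>V. (y v)\<^sup>2) = 1 \<longrightarrow> B x x \<le> B y y"
    by (rule minimizer_on_orthogonal_sphere[OF V cont, of p])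
  then have x: "ip x p = 0" "ip x x = 1"
    and min: "\<And>y. (\<And>v. v \<notin> V \<Longrightarrow> y v = 0) \<Longrightarrow> ip y p = 0 \<Longrightarrow> ip y y = 1 \<Longrightarrow> B x x \<le> B y y"
    unfolding ip_sq by (simp_all add: ip_def)
  define \<mu> where "\<mu> = B x x"
  have ray: "\<mu> * ip y y \<le> B y y" if "ip y p = 0" for y
  proof (cases "ip y y = 0")
    case True
    then have "\<forall>v\<in>V. y v = 0" unfolding ip_sq using V by (simp add: sum_nonneg_eq_0_iff)
    then have "B y y = 0" by (simp add: B_def)
    then show ?thesis using True by simp
  next
    case False
    then have pos: "ip y y > 0" unfolding ip_sq by (metis sum_nonneg zero_le_power2 less_eq_real_def)
    define s where "s = sqrt (ip y y)"
    have s: "s > 0" "s\<^sup>2 = ip y y" using pos by (auto simp: s_def)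
    define z where "z v = (if v \<in> V then y v / s else 0)" for v
    have "ip z p = ip y p / s" by (simp add: ip_def z_def sum_divide_distrib)
    moreover have "ip z z = ip y y / s\<^sup>2"
      by (simp add: ip_def z_def sum_divide_distrib power2_eq_square)
    moreover have "B z z = B y y / s\<^sup>2"
      by (simp add: B_def z_def sum_divide_distrib power2_eq_square)
    ultimately have "B x x \<le> B y y / s\<^sup>2" using min[of z] that s pos by (auto simp: z_def)
    then show ?thesis using s pos by (simp add: \<mu>_def field_simps)
  qed
  have Bp: "B x p = 0" unfolding B_def using null by (simp add: mult.assoc flip: sum_distrib_left)
  have crit: "B x h = \<mu> * ip x h" if "ip h p = 0" for h
  proof -
    have "0 \<le> 2 * t * (B x h - \<mu> * ip x h) + t\<^sup>2 * (B h h - \<mu> * ip h h)" for t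
    proof -
      let ?y = "\<lambda>v. x v + t * h v"
      have "ip ?y p = 0" using x(1) that ip_lin[of p x t h] by (simp add: ip_comm)
      then have "\<mu> * ip ?y ?y \<le> B ?y ?y" by (rule ray)
      moreover have "ip ?y ?y = 1 + 2 * t * ip x h + t\<^sup>2 * ip h h"
      proof -
        have "ip ?y ?y = ip x ?y + t * ip h ?y" unfolding ip_comm[of x ?y] ip_comm[of h ?y] by (rule ip_lin)
        then show ?thesis
          unfolding ip_lin x(2) ip_comm[of h x] by (simp add: power2_eq_square algebra_simps)
      qed
      moreover have "B ?y ?y = \<mu> + 2 * t * B x h + t\<^sup>2 * B h h"
      proof -
        have "B ?y ?y = B x ?y + t * B h ?y" unfolding B_comm[of x ?y] B_comm[of h ?y] by (rule B_lin)
        then show ?thesis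
          unfolding B_lin B_comm[of h x] by (simp add: \<mu>_def power2_eq_square algebra_simps)
      qed
      ultimately show ?thesis by (simp add: algebra_simps)
    qed
    then show ?thesis using quadratic_nonneg_linear_coeff_zero by fastforce
  qed
  have "(\<Sum>v\<in>V. M u v * x v) = \<mu> * x u" if u: "u \<in> V" for u
  proof -
    define \<delta> where "\<delta> v = (if v = u then 1 else 0 :: real)" for v
    define c where "c = ip \<delta> p / ip p p"
    \<comment> \<open>The projection of a unit vector along \<open>p\<close>.\<close>
    define h where "h v = \<delta> v + (- c) * p v" for v
    have "ip p p \<noteq> 0" using p by (simp add: ip_sq)
    then have "ip h p = 0"
      using ip_lin[of p \<delta> "- c" p] unfolding h_def by (simp add: c_def ip_comm)
    then have "B x h = \<mu> * ip x h" by (rule crit)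
    moreover have "B x h = B x \<delta>" "ip x h = ip x \<delta>"
      unfolding h_def B_lin ip_lin using Bp x(1) by simp_all
    moreover have "ip x \<delta> = x u" using u V by (simp add: ip_def \<delta>_def if_distrib cong: if_cong)
    moreover have "B x \<delta> = (\<Sum>v\<in>V. M u v * x v)"
      unfolding B_def \<delta>_def using u V by (simp add: if_distrib sym[of u] mult.commute cong: if_cong)
    ultimately show ?thesis by simp
  qed
  then show ?thesis using that[of x \<mu>] x ray unfolding ip_sq by (auto simp: ip_def B_def)
qed

section \<open>The spectral gap and edge cuts\<close>

lemma vertex_enum:
  assumes "finite V"
  shows "distinct (vertex_enum V)" "set (vertex_enum V) = V" "length (vertex_enum V) = card V"
proof -
  have "\<exists>vs. distinct vs \<and> set vs = V" using finite_distinct_list[OF assms] by auto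
  from someI_ex[OF this] show *: "distinct (vertex_enum V)" "set (vertex_enum V) = V"
    unfolding vertex_enum_def by auto
  show "length (vertex_enum V) = card V" using * distinct_card by fastforce
qed

definition vec_on :: "'v set \<Rightarrow> ('v \<Rightarrow> real) \<Rightarrow> real vec" where
  "vec_on V x = vec (card V) (\<lambda>i. x (vertex_enum V ! i))"

lemma vec_on_eq_iff:
  assumes "finite V"
  shows "vec_on V x = vec_on V y \<longleftrightarrow> (\<forall>v\<in>V. x v = y v)"
proof -
  have "vec_on V x = vec_on V y \<longleftrightarrow> (\<forall>i<length (vertex_enum V). x (vertex_enum V ! i) = y (vertex_enum V ! i))"
    by (auto simp: vec_on_def vec_eq_iff vertex_enum[OF assms])
  also have "\<dots> \<longleftrightarrow> (\<forall>v\<in>set (vertex_enum V). x v = y v)"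
    by (auto simp: all_set_conv_all_nth)
  finally show ?thesis by (simp add: vertex_enum[OF assms])
qed

lemma matrix_on_mult_vec_on:
  assumes "finite V"
  shows "matrix_on V M *\<^sub>v vec_on V x = vec_on V (\<lambda>u. \<Sum>v\<in>V. M u v * x v)"
proof (rule eq_vecI)
  fix i assume "i < dim_vec (vec_on V (\<lambda>u. \<Sum>v\<in>V. M u v * x v))"
  then have i: "i < card V" by (simp add: vec_on_def)
  let ?vs = "vertex_enum V"
  have bij: "bij_betw ((!) ?vs) {0..<card V} V"
    using bij_betw_nth[of ?vs "{0..<card V}" V] vertex_enum[OF assms] by (simp add: lessThan_atLeast0)
  have "(matrix_on V M *\<^sub>v vec_on V x) $ i = (\<Sum>j = 0..<card V. M (?vs ! i) (?vs ! j) * x (?vs ! j))"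
    using i by (simp add: matrix_on_def vec_on_def scalar_prod_def)
  also have "\<dots> = (\<Sum>v\<in>V. M (?vs ! i) v * x v)"
    by (rule sum.reindex_bij_betw[OF bij])
  finally show "(matrix_on V M *\<^sub>v vec_on V x) $ i = vec_on V (\<lambda>u. \<Sum>v\<in>V. M u v * x v) $ i"
    using i by (simp add: vec_on_def)
qed (simp add: matrix_on_def vec_on_def)

lemma matrix_on_second_eigenvalue_le:
  assumes V: "finite V"
    and p: "(\<Sum>v\<in>V. (p v)\<^sup>2) \<noteq> 0" "\<And>u. u \<in> V \<Longrightarrow> (\<Sum>v\<in>V. M u v * p v) = 0"
    and x: "(\<Sum>v\<in>V. (x v)\<^sup>2) \<noteq> 0" "\<And>u. u \<in> V \<Longrightarrow> (\<Sum>v\<in>V. M u v * x v) = \<mu> * x u"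
    and orth: "(\<Sum>v\<in>V. x v * p v) = 0" and \<mu>: "0 \<le> \<mu>"
  shows "sorted_eigenvalues (matrix_on V M) ! 1 \<le> \<mu>"
proof -
  let ?A = "matrix_on V M"
  have A: "?A \<in> carrier_mat (card V) (card V)" by (simp add: matrix_on_def)
  have smult: "c \<cdot>\<^sub>v vec_on V y = vec_on V (\<lambda>v. c * y v)" for c y
    by (rule eq_vecI) (auto simp: vec_on_def)
  have zero: "0\<^sub>v (card V) = vec_on V (\<lambda>_. 0)"
    by (rule eq_vecI) (auto simp: vec_on_def)
  have "[:- 0, 1:] * [:- \<mu>, 1:] dvd char_poly ?A"
  proof (rule char_poly_two_eigenvectors[OF A])
    show "vec_on V p \<in> carrier_vec (card V)" "vec_on V x \<in> carrier_vec (card V)"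
      by (auto simp: vec_on_def)
    show "vec_on V p \<noteq> 0\<^sub>v (card V)"
      using p(1) V by (auto simp: zero vec_on_eq_iff sum_nonneg_eq_0_iff)
    show "?A *\<^sub>v vec_on V p = 0 \<cdot>\<^sub>v vec_on V p"
      using p(2) V by (simp add: matrix_on_mult_vec_on smult vec_on_eq_iff)
    show "?A *\<^sub>v vec_on V x = \<mu> \<cdot>\<^sub>v vec_on V x"
      using x(2) V by (simp add: matrix_on_mult_vec_on smult vec_on_eq_iff)
    show "vec_on V x \<noteq> c \<cdot>\<^sub>v vec_on V p" for c
    proof
      assume "vec_on V x = c \<cdot>\<^sub>v vec_on V p"
      then have eq: "\<forall>v\<in>V. x v = c * p v" using V by (simp add: smult vec_on_eq_iff)
      have "(\<Sum>v\<in>V. x v * x v) = (\<Sum>v\<in>V. c * (x v * p v))"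
        using eq by (intro sum.cong refl) (simp add: mult_ac)
      then show False using x(1) orth by (simp add: power2_eq_square flip: sum_distrib_left)
    qed
  qed
  then show ?thesis using sorted_eigenvalue_1_le[OF A] \<mu> by blast
qed

lemma degree_of_eq_sum:
  assumes "simple_graph V E" "u \<in> V"
  shows "real (degree_of E u) = (\<Sum>v\<in>V. of_bool ({u, v} \<in> E))"
proof -
  have "{e \<in> E. u \<in> e} = (\<lambda>v. {u, v}) ` {v \<in> V. {u, v} \<in> E}"
  proof (intro equalityI subsetI)
    fix e assume "e \<in> {e \<in> E. u \<in> e}"
    then have e: "e \<in> E" "u \<in> e" "e \<subseteq> V" "card e = 2" using assms by (auto simp: simple_graph_def)
    then obtain v where "e = {u, v}" by (auto simp: card_2_iff)
    then show "e \<in> (\<lambda>v. {u, v}) ` {v \<in> V. {u, v} \<in> E}" using e by auto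
  qed auto
  moreover have "inj_on (\<lambda>v. {u, v}) {v \<in> V. {u, v} \<in> E}"
    by (auto simp: inj_on_def doubleton_eq_iff)
  ultimately have "degree_of E u = card {v \<in> V. {u, v} \<in> E}"
    by (simp add: degree_of_def card_image)
  moreover have "finite V" using assms by (simp add: simple_graph_def)
  ultimately show ?thesis by (simp add: of_bool_def sum.If_cases Int_def)
qed

text \<open>
  The substitution \<open>y v = sqrt (degree v) * g v\<close> turns the quadratic form of the normalized Laplacian
  into the Dirichlet energy of \<open>g\<close>. The square roots of the degrees form the null vector, and
  orthogonality to it becomes the condition that \<open>g\<close> has weighted mean zero.
\<close>

lemma lambda1_rayleigh:
  fixes g :: "'v \<Rightarrow> real"
  assumes G: "simple_graph V E" and n: "card V \<ge> 2"
    and deg: "\<And>v. v \<in> V \<Longrightarrow> degree_of E v > 0"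
    and g: "(\<Sum>v\<in>V. real (degree_of E v) * g v) = 0"
  shows "lambda1 V E * (\<Sum>v\<in>V. real (degree_of E v) * (g v)\<^sup>2)
    \<le> (\<Sum>u\<in>V. \<Sum>v\<in>V. of_bool ({u, v} \<in> E) * (g u - g v)\<^sup>2) / 2"
proof -
  define a where "a u v = (of_bool ({u, v} \<in> E) :: real)" for u v
  define d where "d v = real (degree_of E v)" for v
  let ?M = "norm_laplacian E"
  have V: "finite V" using G by (simp add: simple_graph_def)
  have d_sum: "(\<Sum>v\<in>V. a u v) = d u" if "u \<in> V" for u
    using degree_of_eq_sum[OF G that] by (simp add: a_def d_def)
  have a_comm: "a u v = a v u" for u v by (simp add: a_def insert_commute)
  have a_diag: "a u u = 0" for u using G by (auto simp: a_def simple_graph_def)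
  have d_pos: "d v > 0" if "v \<in> V" for v using deg[OF that] by (simp add: d_def)
  have M: "?M u v = of_bool (u = v) - a u v / (sqrt (d u) * sqrt (d v))" if "u \<in> V" "v \<in> V" for u v
    using deg[OF that(1)] a_diag[of u] by (auto simp: norm_laplacian_def a_def d_def real_sqrt_mult)
  have M_sym: "?M u v = ?M v u" for u v
    by (auto simp: norm_laplacian_def insert_commute mult.commute)
  have M_apply: "(\<Sum>v\<in>V. ?M u v * (sqrt (d v) * h v)) = sqrt (d u) * h u - (\<Sum>v\<in>V. a u v * h v) / sqrt (d u)"
    if u: "u \<in> V" for u h
  proof -
    have "(\<Sum>v\<in>V. ?M u v * (sqrt (d v) * h v)) =
        (\<Sum>v\<in>V. (if u = v then sqrt (d u) * h u else 0) - a u v * h v / sqrt (d u))"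
    proof (rule sum.cong)
      fix v assume v: "v \<in> V"
      have "sqrt (d v) \<noteq> 0" "sqrt (d u) \<noteq> 0" using d_pos[OF v] d_pos[OF u] by auto
      then show "?M u v * (sqrt (d v) * h v) = (if u = v then sqrt (d u) * h u else 0) - a u v * h v / sqrt (d u)"
        by (simp add: M[OF u v] field_simps)
    qed simp
    then show ?thesis using u V by (simp add: sum_subtractf sum_divide_distrib)
  qed
  have form: "(\<Sum>u\<in>V. \<Sum>v\<in>V. (sqrt (d u) * h u) * ?M u v * (sqrt (d v) * h v)) =
      (\<Sum>u\<in>V. \<Sum>v\<in>V. a u v * (h u - h v)\<^sup>2) / 2" for h
  proof -
    have "(\<Sum>u\<in>V. \<Sum>v\<in>V. (sqrt (d u) * h u) * ?M u v * (sqrt (d v) * h v)) =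
        (\<Sum>u\<in>V. (sqrt (d u) * h u) * (\<Sum>v\<in>V. ?M u v * (sqrt (d v) * h v)))"
      by (simp add: sum_distrib_left mult_ac)
    also have "\<dots> = (\<Sum>u\<in>V. d u * (h u)\<^sup>2 - (\<Sum>v\<in>V. a u v * (h u * h v)))"
    proof (rule sum.cong)
      fix u assume u: "u \<in> V"
      have s: "sqrt (d u) \<noteq> 0" "sqrt (d u) * sqrt (d u) = d u" using d_pos[OF u] by auto
      have "(sqrt (d u) * h u) * (\<Sum>v\<in>V. ?M u v * (sqrt (d v) * h v)) =
          (sqrt (d u) * sqrt (d u)) * (h u)\<^sup>2 - h u * (\<Sum>v\<in>V. a u v * h v)"
        unfolding M_apply[OF u] using s(1) by (simp add: field_simps power2_eq_square)
      then show "(sqrt (d u) * h u) * (\<Sum>v\<in>V. ?M u v * (sqrt (d v) * h v)) =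
          d u * (h u)\<^sup>2 - (\<Sum>v\<in>V. a u v * (h u * h v))"
        unfolding s(2) by (simp add: sum_distrib_left mult_ac)
    qed simp
    also have "\<dots> = (\<Sum>u\<in>V. d u * (h u)\<^sup>2) - (\<Sum>u\<in>V. \<Sum>v\<in>V. a u v * (h u * h v))"
      by (simp add: sum_subtractf)
    finally have lhs: "(\<Sum>u\<in>V. \<Sum>v\<in>V. (sqrt (d u) * h u) * ?M u v * (sqrt (d v) * h v)) =
      (\<Sum>u\<in>V. d u * (h u)\<^sup>2) - (\<Sum>u\<in>V. \<Sum>v\<in>V. a u v * (h u * h v))" .
    have "(\<Sum>u\<in>V. \<Sum>v\<in>V. a u v * (h u)\<^sup>2) = (\<Sum>u\<in>V. d u * (h u)\<^sup>2)"
      by (simp add: d_sum flip: sum_distrib_right)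
    moreover have "(\<Sum>u\<in>V. \<Sum>v\<in>V. a u v * (h v)\<^sup>2) = (\<Sum>u\<in>V. \<Sum>v\<in>V. a u v * (h u)\<^sup>2)"
      by (subst sum.swap) (simp add: a_comm)
    moreover have "(\<Sum>u\<in>V. \<Sum>v\<in>V. a u v * (h u - h v)\<^sup>2) =
      (\<Sum>u\<in>V. \<Sum>v\<in>V. a u v * (h u)\<^sup>2) + (\<Sum>u\<in>V. \<Sum>v\<in>V. a u v * (h v)\<^sup>2)
      - 2 * (\<Sum>u\<in>V. \<Sum>v\<in>V. a u v * (h u * h v))"
      by (simp add: power2_eq_square algebra_simps sum.distrib sum_subtractf sum_distrib_left)
    ultimately show ?thesis using lhs by simp
  qed
  have form_nonneg: "(\<Sum>u\<in>V. \<Sum>v\<in>V. a u v * (h u - h v)\<^sup>2) / 2 \<ge> 0" for h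
    by (auto intro!: sum_nonneg simp: a_def)
  define p where "p v = sqrt (d v)" for v
  have p2: "(p v)\<^sup>2 = d v" if "v \<in> V" for v using d_pos[OF that] by (simp add: p_def)
  have "V \<noteq> {}" using n by auto
  have p_ne: "(\<Sum>v\<in>V. (p v)\<^sup>2) \<noteq> 0"
    using V d_pos \<open>V \<noteq> {}\<close> sum_pos[of V d] by (simp add: p2)
  have null: "(\<Sum>v\<in>V. ?M u v * p v) = 0" if "u \<in> V" for u
    using M_apply[OF that, of "\<lambda>_. 1"] d_sum[OF that] d_pos[OF that]
    by (simp add: p_def real_div_sqrt)
  obtain \<mu> x where x: "(\<Sum>v\<in>V. x v * p v) = 0" "(\<Sum>v\<in>V. (x v)\<^sup>2) = 1"
    and eig: "\<forall>u\<in>V. (\<Sum>v\<in>V. ?M u v * x v) = \<mu> * x u"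
    and ray: "\<forall>y. (\<Sum>v\<in>V. y v * p v) = 0 \<longrightarrow>
       \<mu> * (\<Sum>v\<in>V. (y v)\<^sup>2) \<le> (\<Sum>u\<in>V. \<Sum>v\<in>V. y u * ?M u v * y v)"
    by (rule rayleigh_minimizer[OF V n M_sym null p_ne])
  have "\<mu> \<ge> 0"
  proof -
    have "\<mu> = (\<Sum>u\<in>V. x u * (\<Sum>v\<in>V. ?M u v * x v))"
      using x(2) by (simp add: eig power2_eq_square mult.left_commute flip: sum_distrib_left)
    also have "\<dots> = (\<Sum>u\<in>V. \<Sum>v\<in>V. x u * ?M u v * x v)"
      by (simp add: sum_distrib_left mult_ac)
    also have "\<dots> = (\<Sum>u\<in>V. \<Sum>v\<in>V. (sqrt (d u) * (x u / sqrt (d u))) * ?M u v * (sqrt (d v) * (x v / sqrt (d v))))"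
      using d_pos by (intro sum.cong refl) (simp add: less_imp_neq[symmetric])
    also have "\<dots> \<ge> 0" using form[of "\<lambda>v. x v / sqrt (d v)"] form_nonneg[of "\<lambda>v. x v / sqrt (d v)"] by linarith
    finally show ?thesis .
  qed
  then have "lambda1 V E \<le> \<mu>"
    unfolding lambda1_def using x(2) eig
    by (intro matrix_on_second_eigenvalue_le[OF V p_ne null _ _ x(1)]) auto
  moreover have "(\<Sum>v\<in>V. d v * (g v)\<^sup>2) \<ge> 0"
    using d_pos by (intro sum_nonneg) (simp add: less_imp_le)
  ultimately have "lambda1 V E * (\<Sum>v\<in>V. d v * (g v)\<^sup>2) \<le> \<mu> * (\<Sum>v\<in>V. d v * (g v)\<^sup>2)"
    by (rule mult_right_mono)
  also have "\<dots> = \<mu> * (\<Sum>v\<in>V. (sqrt (d v) * g v)\<^sup>2)"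
    by (simp add: power_mult_distrib p2[unfolded p_def])
  also have "\<dots> \<le> (\<Sum>u\<in>V. \<Sum>v\<in>V. (sqrt (d u) * g u) * ?M u v * (sqrt (d v) * g v))"
  proof (rule ray[rule_format])
    have "(\<Sum>v\<in>V. sqrt (d v) * g v * p v) = (\<Sum>v\<in>V. d v * g v)"
    proof (rule sum.cong)
      fix v assume "v \<in> V"
      have "sqrt (d v) * g v * p v = (p v)\<^sup>2 * g v" unfolding p_def power2_eq_square by (simp only: mult_ac)
      then show "sqrt (d v) * g v * p v = d v * g v" unfolding p2[OF \<open>v \<in> V\<close>] .
    qed simp
    then show "(\<Sum>v\<in>V. sqrt (d v) * g v * p v) = 0" using g by (simp add: d_def)
  qed
  also have "\<dots> = (\<Sum>u\<in>V. \<Sum>v\<in>V. a u v * (g u - g v)\<^sup>2) / 2" by (rule form)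
  finally show ?thesis by (simp add: a_def d_def)
qed

definition cut_edges :: "'v set set \<Rightarrow> 'v set \<Rightarrow> 'v set set" where
  "cut_edges E S = {e \<in> E. e \<inter> S \<noteq> {} \<and> e - S \<noteq> {}}"

text \<open>
  The test function is the indicator of \<open>S\<close> minus its degree-weighted mean \<open>c\<close>. Bounding each degree
  below by \<open>\<delta>\<close> leaves an unweighted sum of squared deviations from \<open>c\<close>, which is smallest when \<open>c\<close> is
  replaced by the unweighted mean. The resulting bound mentions cardinalities only, not volumes.
\<close>

lemma cut_edges_lower_bound:
  assumes G: "simple_graph V E" and n: "card V \<ge> 2"
    and \<delta>: "0 < \<delta>" "\<And>v. v \<in> V \<Longrightarrow> \<delta> \<le> real (degree_of E v)"
    and l: "lambda1 V E \<ge> 0" and S: "S \<subseteq> V"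
  shows "lambda1 V E * \<delta> * (real (card S) * (real (card V) - real (card S)) / real (card V))
    \<le> real (card (cut_edges E S))"
proof -
  let ?n = "real (card V)" and ?s = "real (card S)"
  define d where "d v = real (degree_of E v)" for v
  define a where "a u v = (of_bool ({u, v} \<in> E) :: real)" for u v
  define f where "f v = (of_bool (v \<in> S) :: real)" for v
  define c where "c = (\<Sum>v\<in>V. d v * f v) / (\<Sum>v\<in>V. d v)"
  have V: "finite V" using G by (simp add: simple_graph_def)
  have Sfin: "finite S" using S V by (rule finite_subset)
  have n0: "?n > 0" "V \<noteq> {}" using n by auto
  have dpos: "d v > 0" if "v \<in> V" for v using \<delta>(2)[OF that] \<delta>(1) by (simp add: d_def)
  have sum_d: "(\<Sum>v\<in>V. d v) \<noteq> 0" using sum_pos[OF V n0(2), of d] dpos by simp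
  have "?s * (?n - ?s) / ?n \<le> (\<Sum>v\<in>V. (f v - c)\<^sup>2)"
  proof -
    have f1: "(\<Sum>v\<in>V. f v) = ?s"
      using V S by (simp add: f_def of_bool_def sum.If_cases Int_absorb1)
    have "(\<Sum>v\<in>V. (f v - c)\<^sup>2) = (\<Sum>v\<in>V. f v - 2 * c * f v + c\<^sup>2)"
      by (intro sum.cong refl) (simp add: f_def power2_eq_square algebra_simps)
    also have "\<dots> = ?s - 2 * c * ?s + ?n * c\<^sup>2"
      by (simp add: sum.distrib sum_subtractf f1 flip: sum_distrib_left)
    finally have sq: "(\<Sum>v\<in>V. (f v - c)\<^sup>2) = ?s - 2 * c * ?s + ?n * c\<^sup>2" .
    have "(\<Sum>v\<in>V. (f v - c)\<^sup>2) - ?s * (?n - ?s) / ?n = (?n * c - ?s)\<^sup>2 / ?n"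
      unfolding sq using n0(1) by (simp add: field_simps power2_eq_square)
    moreover have "(?n * c - ?s)\<^sup>2 / ?n \<ge> 0" by simp
    ultimately show ?thesis by linarith
  qed
  then have "lambda1 V E * \<delta> * (?s * (?n - ?s) / ?n) \<le> lambda1 V E * \<delta> * (\<Sum>v\<in>V. (f v - c)\<^sup>2)"
    using l \<delta>(1) by (intro mult_left_mono) auto
  also have "\<dots> = lambda1 V E * (\<Sum>v\<in>V. \<delta> * (f v - c)\<^sup>2)" by (simp add: sum_distrib_left mult.assoc)
  also have "\<dots> \<le> lambda1 V E * (\<Sum>v\<in>V. d v * (f v - c)\<^sup>2)"
    using l \<delta>(2) by (intro mult_left_mono sum_mono mult_right_mono) (auto simp: d_def)
  also have "\<dots> \<le> (\<Sum>u\<in>V. \<Sum>v\<in>V. a u v * ((f u - c) - (f v - c))\<^sup>2) / 2"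
    unfolding a_def d_def
  proof (rule lambda1_rayleigh[OF G n])
    have "(\<Sum>v\<in>V. d v * (f v - c)) = (\<Sum>v\<in>V. d v * f v) - c * (\<Sum>v\<in>V. d v)"
      by (simp add: algebra_simps sum_subtractf sum_distrib_left)
    then show "(\<Sum>v\<in>V. real (degree_of E v) * (f v - c)) = 0"
      using sum_d by (simp add: c_def d_def)
  qed (use dpos in \<open>simp add: d_def\<close>)
  also have "\<dots> = (\<Sum>u\<in>V. \<Sum>v\<in>V. a u v * of_bool (u \<in> S \<and> v \<notin> S))"
  proof -
    have "a u v * ((f u - c) - (f v - c))\<^sup>2 =
        a u v * of_bool (u \<in> S \<and> v \<notin> S) + a v u * of_bool (v \<in> S \<and> u \<notin> S)" for u v
      by (auto simp: f_def a_def insert_commute)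
    then have "(\<Sum>u\<in>V. \<Sum>v\<in>V. a u v * ((f u - c) - (f v - c))\<^sup>2) =
       (\<Sum>u\<in>V. \<Sum>v\<in>V. a u v * of_bool (u \<in> S \<and> v \<notin> S)) +
       (\<Sum>u\<in>V. \<Sum>v\<in>V. a v u * of_bool (v \<in> S \<and> u \<notin> S))"
      by (simp add: sum.distrib)
    also have "(\<Sum>u\<in>V. \<Sum>v\<in>V. a v u * of_bool (v \<in> S \<and> u \<notin> S)) =
      (\<Sum>u\<in>V. \<Sum>v\<in>V. a u v * of_bool (u \<in> S \<and> v \<notin> S))"
      by (rule sum.swap)
    finally show ?thesis by simp
  qed
  also have "\<dots> = real (card {(u, v) \<in> V \<times> V. {u, v} \<in> E \<and> u \<in> S \<and> v \<notin> S})"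
  proof -
    have "(\<Sum>u\<in>V. \<Sum>v\<in>V. a u v * of_bool (u \<in> S \<and> v \<notin> S)) =
      (\<Sum>z\<in>V \<times> V. of_bool (z \<in> {(u, v). {u, v} \<in> E \<and> u \<in> S \<and> v \<notin> S}))"
      unfolding sum.cartesian_product by (intro sum.cong refl) (auto simp: a_def)
    also have "\<dots> = real (card (V \<times> V \<inter> {(u, v). {u, v} \<in> E \<and> u \<in> S \<and> v \<notin> S}))"
      using V by (simp add: of_bool_def sum.If_cases)
    also have "V \<times> V \<inter> {(u, v). {u, v} \<in> E \<and> u \<in> S \<and> v \<notin> S} =
      {(u, v) \<in> V \<times> V. {u, v} \<in> E \<and> u \<in> S \<and> v \<notin> S}" by auto
    finally show ?thesis .
  qed
  also have "\<dots> \<le> real (card (cut_edges E S))"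
  proof -
    have "finite E" using G by (intro finite_subset[of E "Pow V"]) (auto simp: simple_graph_def)
    then have "finite (cut_edges E S)" by (simp add: cut_edges_def)
    moreover have "inj_on (\<lambda>(u, v). {u, v}) {(u, v) \<in> V \<times> V. {u, v} \<in> E \<and> u \<in> S \<and> v \<notin> S}"
      by (auto simp: inj_on_def doubleton_eq_iff)
    ultimately show ?thesis
      by (subst of_nat_le_iff, intro card_inj_on_le[of "\<lambda>(u, v). {u, v}"])
         (auto simp: cut_edges_def)
  qed
  finally show ?thesis .
qed

section \<open>Edges between the parts of a partition, and counting partitions\<close>

text \<open>
  For an edge \<open>e = {u, v}\<close> inside the domain of an equivalence relation \<open>R\<close>, the condition says that
  \<open>u\<close> and \<open>v\<close> lie in different classes.
\<close>

definition crossing :: "'v set set \<Rightarrow> ('v \<times> 'v) set \<Rightarrow> 'v set set" where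
  "crossing E R = {e \<in> E. \<not> e \<times> e \<subseteq> R}"

lemma finite_edges: "simple_graph V E \<Longrightarrow> finite E"
  by (rule finite_subset[of E "Pow V"]) (auto simp: simple_graph_def)

text \<open>
  A crossing edge lies in the cuts of the two classes of its ends and in no other one.
\<close>

lemma sum_cut_edges_le_crossing:
  assumes G: "simple_graph V E" and R: "equiv V R"
  shows "(\<Sum>A\<in>V // R. card (cut_edges E A)) \<le> 2 * card (crossing E R)"
proof -
  have V: "finite V" using G by (simp add: simple_graph_def)
  have E: "finite E" using G by (rule finite_edges)
  have fq: "finite (V // R)" using V R by (auto intro: finite_quotient elim: equivE)
  have "(\<Sum>A\<in>V // R. card (cut_edges E A)) = (\<Sum>A\<in>V // R. \<Sum>e\<in>E. of_bool (e \<in> cut_edges E A))"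
    using E by (intro sum.cong refl) (simp add: of_bool_def sum.If_cases cut_edges_def Int_def)
  also have "\<dots> = (\<Sum>e\<in>E. \<Sum>A\<in>V // R. of_bool (e \<in> cut_edges E A))"
    by (rule sum.swap)
  also have "\<dots> = (\<Sum>e\<in>E. card {A \<in> V // R. e \<in> cut_edges E A})"
    using fq by (intro sum.cong refl) (simp add: of_bool_def sum.If_cases Int_def)
  also have "\<dots> \<le> (\<Sum>e\<in>E. 2 * of_bool (e \<in> crossing E R))"
  proof (rule sum_mono)
    fix e assume e: "e \<in> E"
    then obtain u v where uv: "e = {u, v}" "u \<in> V" "v \<in> V"
      using G by (force simp: simple_graph_def card_2_iff)
    have cls: "A = R `` {x}" if "A \<in> V // R" "x \<in> A" for A x
      using that R by (metis Image_singleton_iff equiv_class_eq_iff quotientE)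
    have sub: "{A \<in> V // R. e \<in> cut_edges E A} \<subseteq> {R `` {u}, R `` {v}}"
      using cls by (auto simp: cut_edges_def uv)
    show "card {A \<in> V // R. e \<in> cut_edges E A} \<le> 2 * of_bool (e \<in> crossing E R)"
    proof (cases "e \<in> crossing E R")
      case True
      have "card {A \<in> V // R. e \<in> cut_edges E A} \<le> card {R `` {u}, R `` {v}}"
        by (intro card_mono sub) simp
      also have "\<dots> \<le> 2" by (simp add: card_insert_if)
      finally show ?thesis using True by simp
    next
      case False
      then have "(u, v) \<in> R" "(v, u) \<in> R" using e by (auto simp: crossing_def uv)
      then have "{A \<in> V // R. e \<in> cut_edges E A} = {}"
        using cls by (fastforce simp: cut_edges_def uv)
      then show ?thesis by (simp only: card.empty)
    qed
  qed
  also have "\<dots> = 2 * card (crossing E R)"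
    using E by (simp add: of_bool_def sum.If_cases crossing_def Int_def flip: sum_distrib_left)
  finally show ?thesis .
qed

lemma sum_card_quotient:
  assumes "finite V" "equiv V R"
  shows "(\<Sum>A\<in>V // R. card A) = card V"
proof -
  have "card (\<Union>(V // R)) = (\<Sum>A\<in>V // R. card A)"
    using assms quotient_disj[OF assms(2)]
    by (intro card_Union_disjoint) (auto simp: pairwise_def disjnt_def intro: finite_subset[OF in_quotient_imp_subset])
  then show ?thesis using assms by (simp add: Union_quotient)
qed

text \<open>
  In units of \<open>\<lambda>\<^sub>1 \<delta>\<close>, the cut bounds of the classes sum to \<open>n\<close> minus the sum of \<open>|A|\<^sup>2 / n\<close>. Since
  \<open>|A|\<^sup>2 = |A| + |A| (|A| - 1)\<close> and \<open>|A| \<le> b\<close>, that sum of squares is at most \<open>n + b (n - s)\<close>.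
\<close>

lemma crossing_lower_bound:
  assumes G: "simple_graph V E" and n: "card V \<ge> 2"
    and \<delta>: "0 < \<delta>" "\<And>v. v \<in> V \<Longrightarrow> \<delta> \<le> real (degree_of E v)"
    and l: "lambda1 V E \<ge> 0" and R: "equiv V R" and b: "\<And>A. A \<in> V // R \<Longrightarrow> card A \<le> b"
  shows "lambda1 V E * \<delta> * ((real (card (V // R)) - 1)
      + (real (card V) - real (card (V // R))) * (real (card V) - real b) / real (card V))
    \<le> 2 * real (card (crossing E R))"
proof -
  let ?n = "real (card V)" and ?s = "real (card (V // R))" and ?P = "V // R"
  have V: "finite V" using G by (simp add: simple_graph_def)
  have n0: "?n > 0" using n by simp
  have fq: "finite (V // R)" using V R by (auto intro: finite_quotient elim: equivE)
  have sub: "A \<subseteq> V" if "A \<in> ?P" for A using that R by (rule in_quotient_imp_subset[rotated])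
  have ne: "card A \<ge> 1" if "A \<in> ?P" for A
  proof -
    have "A \<noteq> {}" using that R by (rule in_quotient_imp_non_empty[rotated])
    then show ?thesis using finite_subset[OF sub[OF that] V] by (simp add: Suc_leI card_gt_0_iff)
  qed
  have sum_n: "(\<Sum>A\<in>?P. real (card A)) = ?n"
    using sum_card_quotient[OF V R] by (metis of_nat_sum)
  have "(\<Sum>A\<in>?P. real (card A) * (real (card A) - 1)) \<le> (\<Sum>A\<in>?P. real b * (real (card A) - 1))"
    using b ne by (intro sum_mono mult_right_mono) (auto simp: of_nat_le_iff)
  also have "\<dots> = real b * (?n - ?s)"
    by (simp add: sum_n sum_subtractf flip: sum_distrib_left)
  finally have sq: "(\<Sum>A\<in>?P. real (card A) * (real (card A) - 1)) \<le> real b * (?n - ?s)" .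
  have "(?s - 1) + (?n - ?s) * (?n - real b) / ?n = (?n * ?n - ?n - real b * (?n - ?s)) / ?n"
    using n0 by (simp add: field_simps)
  also have "\<dots> \<le> (?n * ?n - ?n - (\<Sum>A\<in>?P. real (card A) * (real (card A) - 1))) / ?n"
    using sq n0 by (intro divide_right_mono) auto
  also have "?n * ?n - ?n - (\<Sum>A\<in>?P. real (card A) * (real (card A) - 1)) = (\<Sum>A\<in>?P. real (card A) * (?n - real (card A)))"
    by (simp add: algebra_simps sum_subtractf sum_n flip: sum_distrib_left sum_distrib_right)
  also have "\<dots> / ?n = (\<Sum>A\<in>?P. real (card A) * (?n - real (card A)) / ?n)"
    by (simp add: sum_divide_distrib)
  finally have "lambda1 V E * \<delta> * ((?s - 1) + (?n - ?s) * (?n - real b) / ?n)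
      \<le> lambda1 V E * \<delta> * (\<Sum>A\<in>?P. real (card A) * (?n - real (card A)) / ?n)"
    using l \<delta>(1) by (intro mult_left_mono) auto
  also have "\<dots> = (\<Sum>A\<in>?P. lambda1 V E * \<delta> * (real (card A) * (?n - real (card A)) / ?n))"
    by (simp add: sum_distrib_left)
  also have "\<dots> \<le> (\<Sum>A\<in>?P. real (card (cut_edges E A)))"
    using sub by (intro sum_mono cut_edges_lower_bound[OF G n \<delta> l])
  also have "\<dots> \<le> 2 * real (card (crossing E R))"
    using sum_cut_edges_le_crossing[OF G R] by (simp flip: of_nat_sum of_nat_le_iff[where ?'a = real])
  finally show ?thesis .
qed

text \<open>
  Choosing a representative in each class presents an equivalence relation as the kernel of an
  idempotent function.
\<close>

lemma equiv_kernel_representative: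
  assumes R: "equiv V R"
  shows "\<exists>rep. (\<forall>v\<in>V. rep v \<in> V) \<and> (\<forall>u\<in>V. \<forall>v\<in>V. rep u = rep v \<longleftrightarrow> (u, v) \<in> R) \<and> (\<forall>v\<in>V. rep (rep v) = rep v)"
proof -
  define rep where "rep v = (SOME x. x \<in> R `` {v})" for v
  have rep: "(v, rep v) \<in> R" if "v \<in> V" for v
  proof -
    have "v \<in> R `` {v}" using that R by (rule equiv_class_self[rotated])
    then have "rep v \<in> R `` {v}" unfolding rep_def by (rule someI)
    then show ?thesis by simp
  qed
  have repV: "rep v \<in> V" if "v \<in> V" for v
    using rep[OF that] R by (meson equiv_class_eq_iff)
  have eq: "rep u = rep v \<longleftrightarrow> (u, v) \<in> R" if "u \<in> V" "v \<in> V" for u v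
  proof
    assume "rep u = rep v"
    then show "(u, v) \<in> R" using rep[OF that(1)] rep[OF that(2)] R by (metis equiv_class_eq_iff)
  next
    assume "(u, v) \<in> R"
    then have "R `` {u} = R `` {v}" using R by (rule equiv_class_eq[rotated])
    then show "rep u = rep v" by (simp add: rep_def)
  qed
  have "rep (rep v) = rep v" if "v \<in> V" for v
    using eq[OF that repV[OF that]] rep[OF that] by simp
  then show ?thesis using repV eq by (intro exI[of _ rep]) auto
qed

text \<open>
  A code describes an equivalence relation by a partial function \<open>g\<close> on the vertices. With the flag
  set, \<open>None\<close> marks the members of one distinguished class, and the relation is the kernel of \<open>g\<close>.
  Without it, \<open>None\<close> marks the vertices that represent their own class, and the relation is the
  kernel of \<open>g\<close> with these values replaced by the vertices themselves. The first form is short if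
  one class is very large, the second if almost all classes are singletons.
\<close>

definition decode :: "'v set \<Rightarrow> bool \<times> ('v \<Rightarrow> 'v option) \<Rightarrow> ('v \<times> 'v) set" where
  "decode V c = (let g = snd c; h = (if fst c then g else (\<lambda>v. case g v of None \<Rightarrow> Some v | Some r \<Rightarrow> Some r))
     in {(u, v) \<in> V \<times> V. h u = h v})"

definition codes :: "'v set \<Rightarrow> (bool \<times> ('v \<Rightarrow> 'v option)) set" where
  "codes V = UNIV \<times> PiE V (\<lambda>_. insert None (Some ` V))"

definition code_size :: "'v set \<Rightarrow> bool \<times> ('v \<Rightarrow> 'v option) \<Rightarrow> nat" where
  "code_size V c = card {v \<in> V. snd c v \<noteq> None}"

lemma equiv_encode:
  assumes V: "finite V" and R: "equiv V R" and A: "A \<in> V // R"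
  shows "\<exists>c\<in>codes V. decode V c = R \<and> code_size V c = min (card V - card (V // R)) (card V - card A)"
proof -
  obtain rep where rep': "(\<forall>v\<in>V. rep v \<in> V) \<and> (\<forall>u\<in>V. \<forall>v\<in>V. rep u = rep v \<longleftrightarrow> (u, v) \<in> R) \<and>
      (\<forall>v\<in>V. rep (rep v) = rep v)"
    by (rule exE[OF equiv_kernel_representative[OF R]])
  have rep: "\<And>v. v \<in> V \<Longrightarrow> rep v \<in> V" "\<And>u v. u \<in> V \<Longrightarrow> v \<in> V \<Longrightarrow> rep u = rep v \<longleftrightarrow> (u, v) \<in> R"
    "\<And>v. v \<in> V \<Longrightarrow> rep (rep v) = rep v"
    using rep' by simp_all
  have RV: "R \<subseteq> V \<times> V" using R by (auto elim: equivE)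
  have AV: "A \<subseteq> V" using R A by (rule in_quotient_imp_subset)
  define g where "g v = (if v \<in> V then if rep v = v then None else Some (rep v) else undefined)" for v
  define g' where "g' v = (if v \<in> V then if v \<in> A then None else Some (rep v) else undefined)" for v
  have 1: "(False, g) \<in> codes V" "(True, g') \<in> codes V"
    using rep(1) by (auto simp: codes_def g_def g'_def PiE_def extensional_def)
  have "decode V (False, g) = {(u, v) \<in> V \<times> V. rep u = rep v}"
    by (auto simp: decode_def g_def split: if_splits)
  then have 2: "decode V (False, g) = R" using rep(2) RV by auto
  obtain x where x: "x \<in> V" "A = R `` {x}" using A by (auto elim: quotientE)
  have sy: "\<And>u v. (u, v) \<in> R \<Longrightarrow> (v, u) \<in> R" and tr: "\<And>u v w. (u, v) \<in> R \<Longrightarrow> (v, w) \<in> R \<Longrightarrow> (u, w) \<in> R"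
    using R by (meson equivE symE, meson equivE transE)
  have inA: "(u, v) \<in> R" if "u \<in> A" "v \<in> A" for u v
    using that x(2) sy[of x u] tr[of u x v] by simp
  have clA: "u \<in> A \<longleftrightarrow> v \<in> A" if "(u, v) \<in> R" for u v
    using that x(2) sy[of u v] tr[of x u v] tr[of x v u] by auto
  have 3: "decode V (True, g') = R"
  proof -
    have "g' u = g' v \<longleftrightarrow> (u, v) \<in> R" if "u \<in> V" "v \<in> V" for u v
      using that rep(2)[OF that] inA[of u v] clA[of u v] by (auto simp: g'_def)
    then show ?thesis using RV by (auto simp: decode_def)
  qed
  have "code_size V (False, g) = card (V - {v \<in> V. rep v = v})"
    unfolding code_size_def by (rule arg_cong[of _ _ card]) (auto simp: g_def)
  also have "\<dots> = card V - card {v \<in> V. rep v = v}" using V by (intro card_Diff_subset) auto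
  also have "card {v \<in> V. rep v = v} = card (V // R)"
  proof (rule bij_betw_same_card[of "\<lambda>v. R `` {v}"], rule bij_betwI')
    show "(R `` {x} = R `` {y}) = (x = y)" if "x \<in> {v \<in> V. rep v = v}" "y \<in> {v \<in> V. rep v = v}" for x y
    proof -
      have "(R `` {x} = R `` {y}) = ((x, y) \<in> R)" using that by (intro eq_equiv_class_iff[OF R]) auto
      then show ?thesis using that rep(2)[of x y] by auto
    qed
    show "R `` {x} \<in> V // R" if "x \<in> {v \<in> V. rep v = v}" for x using that by (auto intro: quotientI)
    show "\<exists>x\<in>{v \<in> V. rep v = v}. B = R `` {x}" if B: "B \<in> V // R" for B
    proof -
      obtain x where x: "x \<in> V" "B = R `` {x}" using B by (rule quotientE)
      have "(x, rep x) \<in> R" using rep(2)[of x "rep x"] rep(1,3) x(1) by auto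
      then have "B = R `` {rep x}" using x(2) equiv_class_eq[OF R] by blast
      then show ?thesis using rep x(1) by blast
    qed
  qed
  finally have 4: "code_size V (False, g) = card V - card (V // R)" .
  have "code_size V (True, g') = card (V - A)"
    unfolding code_size_def by (rule arg_cong[of _ _ card]) (auto simp: g'_def)
  then have 5: "code_size V (True, g') = card V - card A"
    using AV V by (simp add: card_Diff_subset finite_subset)
  show ?thesis
  proof (cases "card V - card (V // R) \<le> card V - card A")
    case True
    then show ?thesis using 1 2 4 by (intro bexI[of _ "(False, g)"]) (auto simp: min_def)
  next
    case False
    then show ?thesis using 1 3 5 by (intro bexI[of _ "(True, g')"]) (auto simp: min_def)
  qed
qed

lemma finite_codes: "finite V \<Longrightarrow> finite (codes V)"
  by (simp add: codes_def finite_PiE)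

text \<open>
  The size of a code is a sum over the vertices, so the generating function of the codes factorizes.
\<close>

lemma sum_code_weights:
  fixes x :: real
  assumes "finite V" "x \<ge> 0"
  shows "(\<Sum>c\<in>codes V. x ^ code_size V c) = 2 * (1 + real (card V) * x) ^ card V"
proof -
  have "(\<Sum>c\<in>codes V. x ^ code_size V c) =
      (\<Sum>b\<in>(UNIV :: bool set). \<Sum>g\<in>PiE V (\<lambda>_. insert None (Some ` V)). \<Prod>v\<in>V. if g v = None then 1 else x)"
    unfolding codes_def sum.cartesian_product using assms(1)
    by (intro sum.cong refl) (auto simp: code_size_def prod.If_cases Int_def)
  also have "\<dots> = 2 * (\<Prod>v\<in>V. \<Sum>y\<in>insert None (Some ` V). if y = None then 1 else x)"
    using assms(1) by (subst prod_sum_PiE) auto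
  also have "(\<Sum>y\<in>insert None (Some ` V). if y = None then 1 else x) = 1 + real (card V) * x"
    using assms(1) by (subst sum.insert) (auto simp: sum.reindex)
  finally show ?thesis by simp
qed

section \<open>Random labels and the number of colours\<close>

lemma powr_le_one_minus:
  fixes x u :: real
  assumes "x > 0" "0 \<le> u" "u \<le> 1"
  shows "x powr u \<le> 1 - u + u * x"
proof -
  have "convex_on UNIV exp" by (rule exp_convex)
  then have "exp ((1 - u) *\<^sub>R 0 + u *\<^sub>R ln x) \<le> (1 - u) * exp 0 + u * exp (ln x)"
    using assms by (intro convex_onD) auto
  then show ?thesis using assms by (simp add: powr_def)
qed

text \<open>
  The left-hand side is log-convex in \<open>m\<close>, equals 1 at \<open>m = 0\<close> and is at most \<open>r\<close> at \<open>m = M\<close>. After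
  division by \<open>r powr (m / M)\<close> log-convexity amounts to convexity of the two exponential terms.
\<close>

lemma exp_mixture_le_powr:
  fixes z r M m t :: real
  assumes z: "0 < z" "z \<le> 1" and M: "0 < M" "0 \<le> m" "m \<le> M"
    and t: "0 < t" and r: "z + (1 - z) * exp (- M / t) \<le> r"
  shows "z + (1 - z) * exp (- m / t) \<le> r powr (m / M)"
proof -
  define u where "u = m / M"
  have u: "0 \<le> u" "u \<le> 1" using M by (auto simp: u_def)
  have "0 \<le> (1 - z) * exp (- M / t)" using z by simp
  then have r0: "0 < r" using r z by linarith
  let ?E = "exp (- M / t)"
  have "exp (- m / t) = ?E powr u"
    using M t by (simp add: u_def powr_def field_simps)
  then have "z + (1 - z) * exp (- m / t) = (z * (1 / r) powr u + (1 - z) * (?E / r) powr u) * r powr u"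
    using r0 by (simp add: powr_divide field_simps)
  also have "\<dots> \<le> (z * (1 - u + u * (1 / r)) + (1 - z) * (1 - u + u * (?E / r))) * r powr u"
    using z u r0 by (intro mult_right_mono add_mono mult_left_mono powr_le_one_minus) auto
  also have "\<dots> \<le> 1 * r powr u"
  proof (intro mult_right_mono)
    have "z * (1 - u + u * (1 / r)) + (1 - z) * (1 - u + u * (?E / r)) =
        1 - u + u * ((z + (1 - z) * ?E) / r)"
      using r0 by (simp add: field_simps)
    also have "\<dots> \<le> 1 - u + u * 1"
      using r r0 u by (intro add_left_mono mult_left_mono) auto
    finally show "z * (1 - u + u * (1 / r)) + (1 - z) * (1 - u + u * (?E / r)) \<le> 1" by simp
  qed simp
  finally show ?thesis by (simp add: u_def)
qed

text \<open>
  The sample space of a uniformly random labelling; probabilities are counted, with total mass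
  \<open>t ^ card E\<close>.
\<close>

definition assignments :: "'e set \<Rightarrow> nat \<Rightarrow> ('e \<Rightarrow> nat) set" where
  "assignments E t = PiE E (\<lambda>_. {..<t})"

lemma finite_assignments: "finite E \<Longrightarrow> finite (assignments E t)"
  by (simp add: assignments_def finite_PiE)

lemma card_assignments: "finite E \<Longrightarrow> card (assignments E t) = t ^ card E"
  by (simp add: assignments_def card_PiE)

lemma card_assignments_avoiding:
  assumes E: "finite E" "Y \<subseteq> E" and t: "i < t"
  shows "real (card {\<omega> \<in> assignments E t. \<forall>e\<in>Y. \<omega> e \<noteq> i}) \<le> real t ^ card E * exp (- real (card Y) / real t)"
proof -
  have Y: "finite Y" using E by (auto intro: finite_subset)
  have "{\<omega> \<in> assignments E t. \<forall>e\<in>Y. \<omega> e \<noteq> i} = PiE E (\<lambda>e. if e \<in> Y then {..<t} - {i} else {..<t})"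
  proof (rule Set.set_eqI)
    fix \<omega>
    have "\<omega> e \<in> (if e \<in> Y then {..<t} - {i} else {..<t}) \<longleftrightarrow> \<omega> e \<in> {..<t} \<and> (e \<in> Y \<longrightarrow> \<omega> e \<noteq> i)" for e
      by simp
    then show "\<omega> \<in> {\<omega> \<in> assignments E t. \<forall>e\<in>Y. \<omega> e \<noteq> i} \<longleftrightarrow>
        \<omega> \<in> PiE E (\<lambda>e. if e \<in> Y then {..<t} - {i} else {..<t})"
      using E(2) unfolding assignments_def PiE_iff mem_Collect_eq by blast
  qed
  then have "card {\<omega> \<in> assignments E t. \<forall>e\<in>Y. \<omega> e \<noteq> i} = (\<Prod>e\<in>E. card (if e \<in> Y then {..<t} - {i} else {..<t}))"
    using E by (simp add: card_PiE)
  also have "real \<dots> = (\<Prod>e\<in>E. if e \<in> Y then real t - 1 else real t)"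
    unfolding of_nat_prod using t by (intro prod.cong refl) (auto simp: of_nat_diff)
  also have "\<dots> = (\<Prod>e\<in>E. real t * (if e \<in> Y then 1 - 1 / real t else 1))"
    using t by (intro prod.cong refl) (auto simp: field_simps)
  also have "\<dots> = real t ^ card E * (1 - 1 / real t) ^ card Y"
    using E by (simp add: prod.distrib prod.If_cases Int_absorb1)
  also have "\<dots> \<le> real t ^ card E * exp (- 1 / real t) ^ card Y"
  proof (intro mult_left_mono power_mono)
    show "1 - 1 / real t \<le> exp (- 1 / real t)" using exp_ge_add_one_self[of "- 1 / real t"] by simp
    show "0 \<le> 1 - 1 / real t" using t by simp
  qed simp
  also have "exp (- 1 / real t) ^ card Y = exp (- real (card Y) / real t)"
    by (simp flip: exp_of_nat_mult)
  finally show ?thesis .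
qed

text \<open>
  The exponential moment of the number of colours with label \<open>i\<close>. Each colour of \<open>X\<close> contributes a
  factor \<open>z + (1 - z) [no edge of this colour has label i]\<close>. Expanding the product over the colours
  leaves only events of the form that no edge of a given set has label \<open>i\<close>, whose probabilities are
  explicit and multiplicative; the same expansion read backwards restores the product.
\<close>

lemma sum_power_card_colors_le:
  fixes \<phi> :: "'e \<Rightarrow> 'c" and z :: real
  assumes E: "finite E" "X \<subseteq> E" and t: "i < t" and z: "0 \<le> z" "z \<le> 1"
  shows "(\<Sum>\<omega>\<in>assignments E t. z ^ card (\<phi> ` {e \<in> X. \<omega> e = i}))
    \<le> real t ^ card E * (\<Prod>k\<in>\<phi> ` X. z + (1 - z) * exp (- real (card {e \<in> X. \<phi> e = k}) / real t))"
proof -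
  have X: "finite X" using E by (auto intro: finite_subset)
  let ?K = "\<phi> ` X" and ?m = "\<lambda>k. card {e \<in> X. \<phi> e = k}"
  let ?av = "\<lambda>\<omega> S. \<forall>e\<in>{e \<in> X. \<phi> e \<in> S}. \<omega> e \<noteq> i"
  have "z ^ card (\<phi> ` {e \<in> X. \<omega> e = i}) =
      (\<Sum>S\<in>Pow ?K. (1 - z) ^ card S * z ^ card (?K - S) * of_bool (?av \<omega> S))" for \<omega>
  proof -
    let ?H = "\<phi> ` {e \<in> X. \<omega> e = i}"
    have "z ^ card ?H = (\<Prod>k\<in>?K. if k \<in> ?H then z else 1)"
      using X by (simp add: prod.If_cases Int_absorb1 image_mono Collect_mono_iff)
    also have "\<dots> = (\<Prod>k\<in>?K. (1 - z) * of_bool (k \<notin> ?H) + z)"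
      by (intro prod.cong refl) auto
    also have "\<dots> = (\<Sum>S\<in>Pow ?K. (\<Prod>k\<in>S. (1 - z) * of_bool (k \<notin> ?H)) * (\<Prod>k\<in>?K - S. z))"
      using X by (intro prod_add) simp
    also have "\<dots> = (\<Sum>S\<in>Pow ?K. (1 - z) ^ card S * z ^ card (?K - S) * of_bool (?av \<omega> S))"
    proof (intro sum.cong refl)
      fix S assume "S \<in> Pow ?K"
      then have "finite S" using X by (auto intro: finite_subset)
      have "(\<Prod>k\<in>S. of_bool (k \<notin> ?H)) = (of_bool (\<forall>k\<in>S. k \<notin> ?H) :: real)"
        using \<open>finite S\<close> by (induction S rule: finite_induct) auto
      moreover have "(\<forall>k\<in>S. k \<notin> ?H) \<longleftrightarrow> ?av \<omega> S" by auto
      ultimately show "(\<Prod>k\<in>S. (1 - z) * of_bool (k \<notin> ?H)) * (\<Prod>k\<in>?K - S. z) =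
          (1 - z) ^ card S * z ^ card (?K - S) * of_bool (?av \<omega> S)"
        by (simp add: prod.distrib)
    qed
    finally show ?thesis .
  qed
  then have "(\<Sum>\<omega>\<in>assignments E t. z ^ card (\<phi> ` {e \<in> X. \<omega> e = i})) =
      (\<Sum>S\<in>Pow ?K. \<Sum>\<omega>\<in>assignments E t. (1 - z) ^ card S * z ^ card (?K - S) * of_bool (?av \<omega> S))"
    by (simp only: sum.swap[of _ "Pow ?K"])
  also have "\<dots> = (\<Sum>S\<in>Pow ?K. (1 - z) ^ card S * z ^ card (?K - S) * real (card {\<omega> \<in> assignments E t. ?av \<omega> S}))"
    using finite_assignments[OF E(1)]
    by (simp add: of_bool_def sum.If_cases Int_def flip: sum_distrib_left)
  also have "\<dots> \<le> (\<Sum>S\<in>Pow ?K. (1 - z) ^ card S * z ^ card (?K - S) *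
      (real t ^ card E * (\<Prod>k\<in>S. exp (- real (?m k) / real t))))"
  proof (intro sum_mono mult_left_mono)
    fix S assume "S \<in> Pow ?K"
    then have S: "finite S" using X by (auto intro: finite_subset)
    have "card {e \<in> X. \<phi> e \<in> S} = (\<Sum>k\<in>S. ?m k)"
    proof -
      have "{e \<in> X. \<phi> e \<in> S} = (\<Union>k\<in>S. {e \<in> X. \<phi> e = k})" by auto
      then show ?thesis using S X by (simp only:, subst card_UN_disjoint) auto
    qed
    then have "- real (card {e \<in> X. \<phi> e \<in> S}) / real t = (\<Sum>k\<in>S. - real (?m k) / real t)"
      by (simp add: sum_negf flip: sum_divide_distrib)
    then have "exp (- real (card {e \<in> X. \<phi> e \<in> S}) / real t) = (\<Prod>k\<in>S. exp (- real (?m k) / real t))"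
      by (simp only: exp_sum[OF S])
    moreover have "real (card {\<omega> \<in> assignments E t. ?av \<omega> S})
        \<le> real t ^ card E * exp (- real (card {e \<in> X. \<phi> e \<in> S}) / real t)"
      using E by (intro card_assignments_avoiding[OF E(1) _ t]) auto
    ultimately show "real (card {\<omega> \<in> assignments E t. ?av \<omega> S})
        \<le> real t ^ card E * (\<Prod>k\<in>S. exp (- real (?m k) / real t))" by simp
  qed (use z in auto)
  also have "\<dots> = real t ^ card E *
      (\<Sum>S\<in>Pow ?K. (\<Prod>k\<in>S. (1 - z) * exp (- real (?m k) / real t)) * (\<Prod>k\<in>?K - S. z))"
    by (simp add: sum_distrib_left prod.distrib mult_ac)
  also have "\<dots> = real t ^ card E * (\<Prod>k\<in>?K. (1 - z) * exp (- real (?m k) / real t) + z)"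
    using X by (subst prod_add) auto
  finally show ?thesis by (simp add: add.commute)
qed

section \<open>The union bound over all partitions\<close>

text \<open>
  Markov's inequality for \<open>z\<close> to the power of the number of colours. By the interpolation between
  \<open>m = 0\<close> and \<open>m = M\<close>, the product over the colours is a power whose exponent is the number of edges
  of \<open>X\<close> in units of \<open>M\<close>, however these edges are distributed among the colours.
\<close>

lemma few_colors_card_le:
  fixes \<phi> :: "'e \<Rightarrow> 'c" and z M y :: real
  assumes E: "finite E" "X \<subseteq> E" and t: "i < t" and z: "0 < z" "z \<le> 1 / 2"
    and M: "0 < M" "\<And>k. real (card {e \<in> E. \<phi> e = k}) \<le> M" "exp (- M / real t) \<le> z\<^sup>2"
    and y: "M * y \<le> real (card X)" and s: "2 \<le> s"
  shows "real (card {\<omega> \<in> assignments E t. card (\<phi> ` {e \<in> X. \<omega> e = i}) + 2 \<le> s})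
    \<le> real t ^ card E * (z powr (y - real s + 2) * (1 + z) powr y)"
proof -
  let ?bad = "{\<omega> \<in> assignments E t. card (\<phi> ` {e \<in> X. \<omega> e = i}) + 2 \<le> s}"
  let ?m = "\<lambda>k. card {e \<in> X. \<phi> e = k}" and ?r = "z * (1 + z)"
  have X: "finite X" using E by (auto intro: finite_subset)
  have "z * (1 + z) \<le> 1 / 2 * (1 + 1)" using z by (intro mult_mono) auto
  then have r: "0 < ?r" "?r \<le> 1" using z by auto
  have "real (card ?bad) * z ^ (s - 2) = (\<Sum>\<omega>\<in>?bad. z ^ (s - 2))" by simp
  also have "\<dots> \<le> (\<Sum>\<omega>\<in>?bad. z ^ card (\<phi> ` {e \<in> X. \<omega> e = i}))"
    using z by (intro sum_mono power_decreasing) auto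
  also have "\<dots> \<le> (\<Sum>\<omega>\<in>assignments E t. z ^ card (\<phi> ` {e \<in> X. \<omega> e = i}))"
    using z by (intro sum_mono2 finite_assignments E) auto
  also have "\<dots> \<le> real t ^ card E * (\<Prod>k\<in>\<phi> ` X. z + (1 - z) * exp (- real (?m k) / real t))"
    using z by (intro sum_power_card_colors_le E t) auto
  also have "\<dots> \<le> real t ^ card E * (\<Prod>k\<in>\<phi> ` X. ?r powr (real (?m k) / M))"
  proof (intro mult_left_mono prod_mono conjI)
    fix k
    have "real (?m k) \<le> real (card {e \<in> E. \<phi> e = k})"
      using E by (intro of_nat_mono card_mono) auto
    then have m: "real (?m k) \<le> M" using M(2)[of k] by linarith
    have "(1 - z) * exp (- M / real t) \<le> 1 * z\<^sup>2"
      using z M(3) by (intro mult_mono) auto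
    then have "z + (1 - z) * exp (- M / real t) \<le> ?r"
      by (simp add: power2_eq_square distrib_left)
    then show "z + (1 - z) * exp (- real (?m k) / real t) \<le> ?r powr (real (?m k) / M)"
      using z M(1) m t by (intro exp_mixture_le_powr) auto
    show "0 \<le> z + (1 - z) * exp (- real (?m k) / real t)" using z by simp
  qed simp
  also have "(\<Prod>k\<in>\<phi> ` X. ?r powr (real (?m k) / M)) = ?r powr (\<Sum>k\<in>\<phi> ` X. real (?m k) / M)"
    using r(1) by (intro powr_sum[symmetric]) (auto simp: X)
  also have "(\<Sum>k\<in>\<phi> ` X. real (?m k) / M) = real (card X) / M"
  proof -
    have "card X = (\<Sum>k\<in>\<phi> ` X. ?m k)"
      using sum.image_gen[OF X, of "\<lambda>_. 1::nat" \<phi>] by simp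
    then show ?thesis by (simp flip: sum_divide_distrib)
  qed
  also have "?r powr (real (card X) / M) \<le> ?r powr y"
    using r M(1) y by (intro powr_mono') (auto simp: field_simps)
  also have "?r powr y = z powr y * (1 + z) powr y" using z by (simp add: powr_mult)
  finally have "real (card ?bad) * z ^ (s - 2) \<le> real t ^ card E * (z powr y * (1 + z) powr y)"
    by (simp add: mult_left_mono)
  moreover have "z ^ (s - 2) = z powr (real s - 2)"
    using z s by (simp add: of_nat_diff flip: powr_realpow)
  ultimately have "real (card ?bad) * z powr (real s - 2) \<le> real t ^ card E * (z powr y * (1 + z) powr y)"
    by simp
  moreover have "z powr y = z powr (y - real s + 2) * z powr (real s - 2)"
    by (simp flip: powr_add)
  ultimately have "real (card ?bad) * z powr (real s - 2)
      \<le> (real t ^ card E * (z powr (y - real s + 2) * (1 + z) powr y)) * z powr (real s - 2)"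
    by (simp add: mult_ac)
  then show ?thesis using z by (simp add: mult_le_cancel_right)
qed

lemma equiv_subset_Times: "equiv V R \<Longrightarrow> R \<subseteq> V \<times> V"
  by (erule equivE)

lemma quotient_finite_card:
  assumes "finite V" "V \<noteq> {}" "equiv V R"
  shows "finite (V // R)" "V // R \<noteq> {}" "card (V // R) \<le> card V"
proof -
  show "finite (V // R)" using assms by (auto intro: finite_quotient elim: equivE)
  show "V // R \<noteq> {}" using assms by (simp add: quotient_is_empty)
  have "V // R = (\<lambda>v. R `` {v}) ` V" by (auto simp: quotient_def)
  then show "card (V // R) \<le> card V" using card_image_le[OF assms(1)] by metis
qed

definition max_class :: "'v set \<Rightarrow> ('v \<times> 'v) set \<Rightarrow> nat" where
  "max_class V R = Max (card ` (V // R))"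

text \<open>
  The last inequality holds because the other \<open>s - 1\<close> classes are nonempty.
\<close>

lemma max_class:
  assumes V: "finite V" "V \<noteq> {}" and R: "equiv V R"
  shows "\<And>A. A \<in> V // R \<Longrightarrow> card A \<le> max_class V R" "\<exists>A\<in>V // R. card A = max_class V R"
    "max_class V R \<le> card V" "max_class V R + card (V // R) \<le> card V + 1"
proof -
  note Q = quotient_finite_card[OF V R]
  show le: "card A \<le> max_class V R" if "A \<in> V // R" for A
    unfolding max_class_def using that Q by (intro Max_ge) auto
  have "max_class V R \<in> card ` (V // R)" unfolding max_class_def using Q by (intro Max_in) auto
  then show ex: "\<exists>A\<in>V // R. card A = max_class V R" by auto
  then obtain A where A: "A \<in> V // R" "card A = max_class V R" by auto
  have "A \<subseteq> V" using R A(1) by (rule in_quotient_imp_subset)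
  then show "max_class V R \<le> card V" using A(2) V(1) card_mono by metis
  have "card (V // R - {A}) \<le> (\<Sum>B\<in>V // R - {A}. card B)"
  proof -
    have "1 \<le> card B" if "B \<in> V // R" for B
    proof -
      have "B \<noteq> {}" "B \<subseteq> V" using R that by (auto dest: in_quotient_imp_non_empty in_quotient_imp_subset)
      then show ?thesis using V(1) by (simp add: Suc_leI card_gt_0_iff finite_subset)
    qed
    then have "(\<Sum>B\<in>V // R - {A}. 1) \<le> (\<Sum>B\<in>V // R - {A}. card B)" by (intro sum_mono) auto
    then show ?thesis by simp
  qed
  also have "card A + (\<Sum>B\<in>V // R - {A}. card B) = card V"
    using sum_card_quotient[OF V(1) R] sum.remove[OF Q(1) A(1), of card] by simp
  finally show "max_class V R + card (V // R) \<le> card V + 1"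
    using A Q by (simp add: card_Diff_singleton)
qed

text \<open>
  The length of the shorter of the two descriptions of a partition in \<open>equiv_encode\<close>.
\<close>

definition coarseness :: "'v set \<Rightarrow> ('v \<times> 'v) set \<Rightarrow> nat" where
  "coarseness V R = min (card V - card (V // R)) (card V - max_class V R)"

text \<open>
  The two factors on the right sum to at least \<open>n - 1\<close>, so the larger one is at least \<open>n / 4\<close>.
\<close>

lemma coarseness_le_product:
  assumes V: "finite V" "card V \<ge> 2" and R: "equiv V R"
  shows "real (coarseness V R) / 4
    \<le> (real (card V) - real (card (V // R))) * (real (card V) - real (max_class V R)) / real (card V)"
proof -
  let ?n = "real (card V)"
  have ne: "V \<noteq> {}" using V by auto
  note Q = quotient_finite_card[OF V(1) ne R] and mc = max_class[OF V(1) ne R]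
  define k a where "k = card V - card (V // R)" and "a = card V - max_class V R"
  have k: "real k = ?n - real (card (V // R))" and a: "real a = ?n - real (max_class V R)"
    using Q(3) mc(3) by (auto simp: k_def a_def of_nat_diff)
  have ka: "real k + real a \<ge> ?n - 1" using mc(4) by (simp add: k a)
  have mx: "max (real k) (real a) \<ge> ?n / 4" using ka V(2) by (auto simp: max_def)
  have "min (real k) (real a) * (?n / 4) \<le> min (real k) (real a) * max (real k) (real a)"
    using mx by (intro mult_left_mono) auto
  also have "\<dots> = real k * real a" by (simp add: min_def max_def)
  finally have "min (real k) (real a) / 4 \<le> real k * real a / ?n"
    using V(2) by (simp add: field_simps)
  moreover have "real (coarseness V R) = min (real k) (real a)"
    by (simp add: coarseness_def k_def a_def of_nat_min)
  ultimately show ?thesis by (simp add: k a)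
qed

lemma sum_coarseness_weights:
  fixes x :: real
  assumes V: "finite V" "V \<noteq> {}" and x: "0 \<le> x" and RR: "\<RR> \<subseteq> {R. equiv V R}"
  shows "(\<Sum>R\<in>\<RR>. x ^ coarseness V R) \<le> 2 * (1 + real (card V) * x) ^ card V"
proof -
  have "\<RR> \<subseteq> Pow (V \<times> V)" using RR equiv_subset_Times by blast
  then have "finite \<RR>" using V by (auto intro: finite_subset)
  moreover have "\<exists>c\<in>codes V. decode V c = R \<and> x ^ coarseness V R \<le> x ^ code_size V c" if R: "R \<in> \<RR>" for R
  proof -
    have eq: "equiv V R" using that RR by auto
    obtain A where "A \<in> V // R" "card A = max_class V R" using max_class(2)[OF V eq] by auto
    then show ?thesis using equiv_encode[OF V(1) eq, of A] by (auto simp: coarseness_def)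
  qed
  ultimately have "(\<Sum>R\<in>\<RR>. x ^ coarseness V R) \<le> (\<Sum>c\<in>codes V. x ^ code_size V c)"
    using x by (intro sum_le_included[where i = "decode V"]) (auto simp: finite_codes V)
  then show ?thesis using sum_code_weights[OF V(1) x] by simp
qed

text \<open>
  The union bound. A partition \<open>R\<close> is bad for a label on a fraction of at most
  \<open>3 z / n ^ (3 * coarseness V R)\<close> of all labellings, and the weights \<open>1 / n ^ (3 * coarseness V R)\<close>
  sum to at most 6.
\<close>

lemma exists_good_assignment:
  fixes \<phi> :: "'v set \<Rightarrow> 'c" and z M \<delta> :: real
  assumes G: "simple_graph V E" and n: "card V \<ge> 2"
    and \<delta>: "0 < \<delta>" "\<And>v. v \<in> V \<Longrightarrow> \<delta> \<le> real (degree_of E v)"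
    and M: "M = lambda1 V E * \<delta> / 2" "0 < M" "\<And>k. real (card {e \<in> E. \<phi> e = k}) \<le> M"
    and t: "0 < t"
    and z: "0 < z" "z \<le> 1 / 2" "exp (- M / real t) \<le> z\<^sup>2" "2 * real (card V) * z \<le> 1"
      "z powr (1 / 4) \<le> 1 / real (card V) ^ 3" "18 * z * real t < 1"
  shows "\<exists>\<omega>\<in>assignments E t. \<forall>i<t. \<forall>R. equiv V R \<longrightarrow> card (V // R) \<ge> 2 \<longrightarrow>
    card (V // R) \<le> card (\<phi> ` {e \<in> crossing E R. \<omega> e = i}) + 1"
proof (rule ccontr)
  let ?n = "real (card V)" and ?x = "1 / real (card V) ^ 3"
  assume contr: "\<not> ?thesis"
  have V: "finite V" "V \<noteq> {}" using G n by (auto simp: simple_graph_def)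
  have E: "finite E" using G by (rule finite_edges)
  define \<RR> where "\<RR> = {R. equiv V R \<and> card (V // R) \<ge> 2}"
  have "\<RR> \<subseteq> Pow (V \<times> V)" unfolding \<RR>_def using equiv_subset_Times by blast
  then have RR: "finite \<RR>" using V by (auto intro: finite_subset)
  define bad where "bad i R = {\<omega> \<in> assignments E t. card (\<phi> ` {e \<in> crossing E R. \<omega> e = i}) + 2 \<le> card (V // R)}"
    for i R
  have bad: "real (card (bad i R)) \<le> real t ^ card E * (3 * z * ?x ^ coarseness V R)"
    if i: "i < t" and R: "R \<in> \<RR>" for i R
  proof -
    have eq: "equiv V R" and s2: "2 \<le> card (V // R)" using R by (auto simp: \<RR>_def)
    note Q = quotient_finite_card[OF V eq] and mc = max_class[OF V eq]
    let ?s = "real (card (V // R))"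
    define p where "p = (?n - ?s) * (?n - real (max_class V R)) / ?n"
    define y where "y = ?s - 1 + p"
    have "0 < lambda1 V E * \<delta>" using M(1,2) by linarith
    then have l: "lambda1 V E \<ge> 0" using \<delta>(1) by (simp add: zero_less_mult_iff)
    have "lambda1 V E * \<delta> * y \<le> 2 * real (card (crossing E R))"
      unfolding y_def p_def by (rule crossing_lower_bound[OF G n \<delta> l eq mc(1)])
    then have My: "M * y \<le> real (card (crossing E R))" by (simp add: M(1))
    have p: "real (coarseness V R) / 4 \<le> p" unfolding p_def by (rule coarseness_le_product[OF V(1) n eq])
    have "p \<le> ?n * ?n / ?n"
      unfolding p_def using Q(3) mc(3) by (intro divide_right_mono mult_mono) auto
    then have y: "0 \<le> y" "y \<le> 2 * ?n" using p s2 Q(3) n by (auto simp: y_def)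
    have "(1 + z) powr y \<le> exp z powr y"
      using z y by (intro powr_mono2) auto
    also have "\<dots> = exp (z * y)" by (simp add: powr_def mult.commute)
    also have "z * y \<le> z * (2 * ?n)" using y z by (intro mult_left_mono) auto
    then have "exp (z * y) \<le> exp 1" using z(4) by (simp add: mult_ac)
    also have "exp 1 \<le> (3::real)" by (rule exp_le)
    finally have pz: "(1 + z) powr y \<le> 3" .
    have "z powr (y - ?s + 2) = z powr (1 + p)" by (simp add: y_def)
    also have "\<dots> = z powr 1 * z powr p" by (rule powr_add)
    also have "\<dots> \<le> z * z powr (real (coarseness V R) / 4)"
      using z p by (simp add: powr_mono')
    also have "z powr (real (coarseness V R) / 4) = (z powr (1 / 4)) powr real (coarseness V R)"
      unfolding powr_powr by simp
    also have "\<dots> = (z powr (1 / 4)) ^ coarseness V R"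
      using z by (intro powr_realpow) simp
    also have "\<dots> \<le> ?x ^ coarseness V R" using z by (intro power_mono) auto
    finally have "z powr (y - ?s + 2) \<le> z * ?x ^ coarseness V R" using z by simp
    then have wt: "z powr (y - ?s + 2) * (1 + z) powr y \<le> (z * ?x ^ coarseness V R) * 3"
      using pz z by (intro mult_mono) auto
    have "real (card (bad i R)) \<le> real t ^ card E * (z powr (y - ?s + 2) * (1 + z) powr y)"
      unfolding bad_def
    proof (rule few_colors_card_le[OF E])
      show "crossing E R \<subseteq> E" by (auto simp: crossing_def)
    qed (use z(1-3) M(2,3) My s2 i in auto)
    also have "\<dots> \<le> real t ^ card E * ((z * ?x ^ coarseness V R) * 3)"
      using wt by (intro mult_left_mono) auto
    finally show ?thesis by (simp add: mult_ac)
  qed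
  have "assignments E t \<subseteq> (\<Union>(i, R)\<in>{..<t} \<times> \<RR>. bad i R)"
  proof
    fix \<omega> assume w: "\<omega> \<in> assignments E t"
    then obtain i R where "i < t" "equiv V R" "card (V // R) \<ge> 2"
      "\<not> card (V // R) \<le> card (\<phi> ` {e \<in> crossing E R. \<omega> e = i}) + 1"
      using contr by blast
    then have "(i, R) \<in> {..<t} \<times> \<RR>" "\<omega> \<in> bad i R" using w by (auto simp: \<RR>_def bad_def)
    then show "\<omega> \<in> (\<Union>(i, R)\<in>{..<t} \<times> \<RR>. bad i R)" by blast
  qed
  moreover have fin: "finite (bad i R)" for i R using finite_assignments[OF E] by (simp add: bad_def)
  ultimately have "card (assignments E t) \<le> card (\<Union>(i, R)\<in>{..<t} \<times> \<RR>. bad i R)"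
    using RR by (intro card_mono) auto
  also have "\<dots> \<le> (\<Sum>(i, R)\<in>{..<t} \<times> \<RR>. card (bad i R))"
    using RR card_UN_le[of "{..<t} \<times> \<RR>" "\<lambda>(i, R). bad i R"] by (simp add: case_prod_unfold)
  finally have "real (t ^ card E) \<le> real (\<Sum>(i, R)\<in>{..<t} \<times> \<RR>. card (bad i R))"
    by (simp only: card_assignments[OF E] of_nat_le_iff)
  also have "\<dots> = (\<Sum>i<t. \<Sum>R\<in>\<RR>. real (card (bad i R)))"
    by (simp add: sum.cartesian_product case_prod_unfold)
  also have "\<dots> \<le> (\<Sum>i<t. \<Sum>R\<in>\<RR>. real t ^ card E * (3 * z * ?x ^ coarseness V R))"
    using bad by (intro sum_mono) auto
  also have "\<dots> = real t ^ card E * (3 * z * real t) * (\<Sum>R\<in>\<RR>. ?x ^ coarseness V R)"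
    by (simp add: sum_distrib_left mult_ac)
  also have "\<dots> \<le> real t ^ card E * (3 * z * real t) * 6"
  proof (intro mult_left_mono)
    have n0: "?n > 0" using n by simp
    have "(\<Sum>R\<in>\<RR>. ?x ^ coarseness V R) \<le> 2 * (1 + ?n * ?x) ^ card V"
      by (intro sum_coarseness_weights V) (auto simp: \<RR>_def)
    also have "(1 + ?n * ?x) ^ card V \<le> exp (?n * ?x) ^ card V"
      by (intro power_mono) (auto simp: add.commute)
    also have "\<dots> = exp (?n * (?n * ?x))" by (simp flip: exp_of_nat_mult)
    also have "?n * (?n * ?x) = 1 / ?n" using n0 by (simp add: power3_eq_cube)
    also have "exp (1 / ?n) \<le> exp 1" using n by simp
    also have "exp 1 \<le> (3::real)" by (rule exp_le)
    finally show "(\<Sum>R\<in>\<RR>. ?x ^ coarseness V R) \<le> 6" by simp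
  qed (use z in auto)
  also have "\<dots> = real t ^ card E * (18 * z * real t)" by simp
  finally have le: "real t ^ card E \<le> real t ^ card E * (18 * z * real t)" by simp
  moreover have "real t ^ card E > 0" using t by simp
  ultimately show False using z(6) by simp
qed

section \<open>Edge-disjoint rainbow spanning trees\<close>

text \<open>
  If deleting the colours outside \<open>K\<close> leaves \<open>s \<ge> 2\<close> components, then the edges between them have no
  colour in \<open>K\<close>. So the assumption for the partition into these components is Rado's condition for \<open>K\<close>.
\<close>

lemma rainbow_tree_of_colorful:
  fixes \<phi> :: "'v set \<Rightarrow> 'c"
  assumes F: "simple_graph V F" and V: "V \<noteq> {}"
    and colorful: "\<And>R. equiv V R \<Longrightarrow> card (V // R) \<ge> 2 \<Longrightarrow> card (V // R) \<le> card (\<phi> ` crossing F R) + 1"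
  obtains T where "spanning_tree V F T" "rainbow \<phi> T"
proof (rule rainbow_spanning_tree_exists[OF F V])
  fix K assume K: "K \<subseteq> \<phi> ` F"
  let ?R = "reach V {e \<in> F. \<phi> e \<in> K}"
  show "num_comp V {e \<in> F. \<phi> e \<in> K} \<le> 1 + card (\<phi> ` F - K)"
  proof (cases "card (V // ?R) \<ge> 2")
    case True
    have "\<phi> ` crossing F ?R \<subseteq> \<phi> ` F - K"
    proof
      fix k assume "k \<in> \<phi> ` crossing F ?R"
      then obtain e where e: "e \<in> F" "\<not> e \<times> e \<subseteq> ?R" "k = \<phi> e"
        unfolding crossing_def by blast
      have "e \<subseteq> V" "card e = 2" using F e(1) by (auto simp: simple_graph_def)
      then obtain u v where uv: "e = {u, v}" "u \<in> V" "v \<in> V"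
        by (auto simp: card_2_iff)
      have "k \<notin> K"
      proof
        assume "k \<in> K"
        then have "{u, v} \<in> {e \<in> F. \<phi> e \<in> K}" using e uv by simp
        then have "(u, v) \<in> ?R" "(v, u) \<in> ?R" "(u, u) \<in> ?R" "(v, v) \<in> ?R"
          using uv by (auto intro: edge_in_reach reach_refl reach_sym)
        then show False using e(2) uv(1) by auto
      qed
      then show "k \<in> \<phi> ` F - K" using e by auto
    qed
    then have "card (\<phi> ` crossing F ?R) \<le> card (\<phi> ` F - K)"
      using finite_edges[OF F] by (intro card_mono) auto
    then show ?thesis using colorful[OF equiv_reach True] by (simp add: num_comp_def)
  qed (simp add: num_comp_def)
qed (rule that)

text \<open>
  The cut around a single vertex has at most \<open>n\<close> edges. This keeps the number of labels polynomial in
  the number of vertices, as the union bound requires.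
\<close>

lemma lambda1_min_degree_le:
  assumes G: "simple_graph V E" and n: "card V \<ge> 2"
    and \<delta>: "0 < \<delta>" "\<And>v. v \<in> V \<Longrightarrow> \<delta> \<le> real (degree_of E v)"
    and l: "lambda1 V E \<ge> 0"
  shows "lambda1 V E * \<delta> \<le> 2 * real (card V)"
proof -
  let ?n = "real (card V)"
  have V: "finite V" using G by (simp add: simple_graph_def)
  obtain v where v: "v \<in> V" using n by fastforce
  have "lambda1 V E * \<delta> * (1 / 2) \<le> lambda1 V E * \<delta> * (real (card {v}) * (?n - real (card {v})) / ?n)"
    using n l \<delta>(1) by (intro mult_left_mono) (auto simp: field_simps)
  also have "\<dots> \<le> real (card (cut_edges E {v}))"
    using v by (intro cut_edges_lower_bound[OF G n \<delta> l]) auto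
  also have "\<dots> \<le> real (degree_of E v)"
    unfolding degree_of_def using finite_edges[OF G]
    by (intro of_nat_mono card_mono) (auto simp: cut_edges_def)
  also have "\<dots> \<le> (\<Sum>u\<in>V. 1)"
    unfolding degree_of_eq_sum[OF G v] by (intro sum_mono) auto
  finally show ?thesis by simp
qed

text \<open>
  The value of \<open>z\<close> is a compromise. Interpolating with base \<open>z (1 + z)\<close> requires \<open>exp (- M / t) \<le> z\<^sup>2\<close>,
  and the choice of \<open>t\<close> makes the left-hand side at most \<open>n powr (- C / 2)\<close>. The union bound requires
  the fourth root of \<open>z\<close> to be at most \<open>n powr (- 3)\<close>, which is where \<open>C \<ge> 48\<close> comes from.
\<close>

lemma disjoint_rainbow_trees:
  fixes \<phi> :: "'v set \<Rightarrow> 'c"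
  assumes C: "C \<ge> 48" and G: "simple_graph V E" and n: "card V \<ge> 3"
    and \<delta>: "0 < \<delta>" "\<And>v. v \<in> V \<Longrightarrow> \<delta> \<le> real (degree_of E v)"
    and col: "\<And>k. real (card {e \<in> E. \<phi> e = k}) \<le> lambda1 V E * \<delta> / 2"
    and t: "0 < t" "real t \<le> lambda1 V E * \<delta> / (C * ln (real (card V)))"
  shows "\<exists>\<T>. finite \<T> \<and> card \<T> = t \<and> (\<forall>T\<in>\<T>. spanning_tree V E T \<and> rainbow \<phi> T) \<and> pairwise disjnt \<T>"
proof -
  let ?n = "real (card V)"
  define M where "M = lambda1 V E * \<delta> / 2"
  define z where "z = ?n powr (- C / 4)"
  have n3: "?n \<ge> 3" using n by simp
  have n2: "card V \<ge> 2" using n by simp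
  have "exp 1 \<le> ?n" using n3 exp_le by linarith
  then have ln1: "ln ?n \<ge> 1" using n3 by (subst ln_ge_iff) auto
  have Cln: "C * ln ?n \<ge> 48 * 1" using C ln1 by (intro mult_mono) auto
  have tC: "real t * (C * ln ?n) \<le> 2 * M" using t(2) Cln by (simp add: M_def field_simps)
  have "0 < C * ln ?n" using Cln by linarith
  then have "0 < real t * (C * ln ?n)" using t(1) by simp
  then have "0 < M" using tC by linarith
  then have "0 < lambda1 V E * \<delta>" by (simp add: M_def)
  then have l: "lambda1 V E \<ge> 0" using \<delta>(1) by (simp add: zero_less_mult_iff)
  have "real t * 48 \<le> real t * (C * ln ?n)" using Cln by (intro mult_left_mono) auto
  also have "\<dots> \<le> 2 * M" by (rule tC)
  also have "\<dots> \<le> 2 * ?n" using lambda1_min_degree_le[OF G n2 \<delta> l] by (simp add: M_def)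
  finally have tn: "real t \<le> ?n" by simp
  have z0: "0 < z" using n3 by (simp add: z_def)
  have z12: "z \<le> 1 / ?n ^ 12"
  proof -
    have "z \<le> ?n powr (- 12)" unfolding z_def using n3 C by (intro powr_mono) auto
    also have "\<dots> = 1 / ?n ^ 12" using n3 by (simp add: powr_minus_divide powr_numeral)
    finally show ?thesis .
  qed
  \<comment> \<open>The factor 81, the fourth power of 3, leaves room for the constants 2 and 18 in the requirements on \<open>z\<close>.\<close>
  have pow: "81 * ?n ^ 2 \<le> ?n ^ 12"
  proof -
    have "3 ^ 4 * ?n ^ 2 \<le> ?n ^ 4 * ?n ^ 2" using n3 by (intro mult_right_mono power_mono) auto
    also have "\<dots> = ?n ^ 6" by (simp flip: power_add)
    also have "\<dots> \<le> ?n ^ 12" using n3 by (intro power_increasing) auto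
    finally show ?thesis by simp
  qed
  have zn: "81 * (z * ?n ^ 2) \<le> 1"
  proof -
    have "81 * (z * ?n ^ 2) \<le> 1 / ?n ^ 12 * (81 * ?n ^ 2)"
      using z12 mult_right_mono[OF z12, of "81 * ?n ^ 2"] by (simp add: mult_ac)
    also have "\<dots> \<le> 1" using pow n3 by (simp add: field_simps)
    finally show ?thesis .
  qed
  have "?n * 1 \<le> ?n ^ 2" unfolding power2_eq_square using n3 by (intro mult_left_mono) auto
  then have n_sq: "?n \<le> ?n ^ 2" "1 \<le> ?n ^ 2" using n3 by auto
  have zz: "z * ?n \<le> z * ?n ^ 2" "z * 1 \<le> z * ?n ^ 2" "z * real t \<le> z * ?n ^ 2"
    using z0 n_sq tn by (auto intro!: mult_left_mono)
  have "\<exists>\<omega>\<in>assignments E t. \<forall>i<t. \<forall>R. equiv V R \<longrightarrow> card (V // R) \<ge> 2 \<longrightarrow>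
    card (V // R) \<le> card (\<phi> ` {e \<in> crossing E R. \<omega> e = i}) + 1"
  proof (rule exists_good_assignment[OF G n2 \<delta> M_def \<open>0 < M\<close> _ t(1) z0])
    show "z \<le> 1 / 2" "2 * ?n * z \<le> 1" "18 * z * real t < 1"
      using zn zz by (simp_all add: mult_ac)
    show "exp (- M / real t) \<le> z\<^sup>2"
    proof -
      have "z\<^sup>2 = exp (- (C * ln ?n) / 2)"
        using n3 by (simp add: z_def powr_def power2_eq_square flip: exp_add)
      moreover have "- M / real t \<le> - (C * ln ?n) / 2"
        using tC t(1) by (simp add: field_simps)
      ultimately show ?thesis by simp
    qed
    show "z powr (1 / 4) \<le> 1 / ?n ^ 3"
    proof -
      have "z powr (1 / 4) = ?n powr (- C / 16)" by (simp add: z_def powr_powr)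
      also have "\<dots> \<le> ?n powr (- 3)" using n3 C by (intro powr_mono) auto
      also have "\<dots> = 1 / ?n ^ 3" using n3 by (simp add: powr_minus_divide powr_numeral)
      finally show ?thesis .
    qed
    show "real (card {e \<in> E. \<phi> e = k}) \<le> M" for k
      unfolding M_def by (rule col)
  qed
  then obtain \<omega> where good: "\<And>i R. i < t \<Longrightarrow> equiv V R \<Longrightarrow> card (V // R) \<ge> 2 \<Longrightarrow>
    card (V // R) \<le> card (\<phi> ` {e \<in> crossing E R. \<omega> e = i}) + 1"
    by blast
  define F where "F i = {e \<in> E. \<omega> e = i}" for i
  have "\<exists>T. spanning_tree V (F i) T \<and> rainbow \<phi> T" if "i < t" for i
  proof -
    have "simple_graph V (F i)" "V \<noteq> {}" using G n by (auto simp: simple_graph_def F_def)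
    moreover have "crossing (F i) R = {e \<in> crossing E R. \<omega> e = i}" for R
      by (auto simp: crossing_def F_def)
    ultimately show ?thesis
      using rainbow_tree_of_colorful[of V "F i" \<phi>] good[OF that] by metis
  qed
  then obtain T where T: "\<And>i. i < t \<Longrightarrow> spanning_tree V (F i) (T i) \<and> rainbow \<phi> (T i)" by metis
  have TF: "T i \<subseteq> F i" if "i < t" for i using T[OF that] by (simp add: spanning_tree_def)
  have disj: "T i \<inter> T j = {}" if "i < t" "j < t" "i \<noteq> j" for i j
    using TF[OF that(1)] TF[OF that(2)] that(3) by (auto simp: F_def)
  have ne: "T i \<noteq> {}" if "i < t" for i
  proof
    assume "T i = {}"
    then have "connected_graph V {}" using T[OF that] by (simp add: spanning_tree_def is_tree_def)
    then have "\<forall>u\<in>V. \<forall>v\<in>V. u = v" by (simp add: connected_graph_def)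
    then have "card V \<le> 1" by (metis One_nat_def card_le_Suc0_iff_eq card.infinite le0)
    then show False using n by simp
  qed
  have inj: "inj_on T {..<t}"
    using disj ne by (intro inj_onI) (metis inf.idem lessThan_iff)
  show ?thesis
  proof (intro exI[of _ "T ` {..<t}"] conjI)
    show "card (T ` {..<t}) = t" using card_image[OF inj] by simp
    show "pairwise disjnt (T ` {..<t})"
      using disj by (auto simp: pairwise_def disjnt_def)
    show "\<forall>T'\<in>T ` {..<t}. spanning_tree V E T' \<and> rainbow \<phi> T'"
      using T TF by (auto simp: spanning_tree_def F_def)
  qed simp
qed

theorem theorem1:
  shows "\<exists>(C0::real) (n0::nat). \<forall>C\<ge>C0. \<forall>n\<ge>n0.
    \<forall>(V :: 'v set) (E :: 'v set set) (\<phi> :: 'v set \<Rightarrow> 'c).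
      simple_graph V E \<longrightarrow> card V = n \<longrightarrow>
      real (min_degree V E) \<ge> C * ln (real n) \<longrightarrow>
      (\<forall>k. real (card (color_class E \<phi> k)) \<le> real (min_degree V E) * lambda1 V E / 2) \<longrightarrow>
      (\<exists>\<T> :: 'v set set set.
         finite \<T> \<and>
         int (card \<T>) \<ge> \<lfloor>real (min_degree V E) * lambda1 V E / (C * ln (real n))\<rfloor> \<and>
         (\<forall>T\<in>\<T>. spanning_tree V E T \<and> rainbow \<phi> T) \<and>
         pairwise disjnt \<T>)"
proof (rule exI[of _ 48], rule exI[of _ 3], intro allI impI)
  fix C :: real and n :: nat and V :: "'v set" and E :: "'v set set" and \<phi> :: "'v set \<Rightarrow> 'c"
  assume C: "48 \<le> C" and n: "3 \<le> n" and G: "simple_graph V E" and card: "card V = n"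
    and deg: "C * ln (real n) \<le> real (min_degree V E)"
    and col: "\<forall>k. real (card (color_class E \<phi> k)) \<le> real (min_degree V E) * lambda1 V E / 2"
  let ?\<delta> = "real (min_degree V E)"
  define q where "q = ?\<delta> * lambda1 V E / (C * ln (real n))"
  show "\<exists>\<T>. finite \<T> \<and> int (card \<T>) \<ge> \<lfloor>?\<delta> * lambda1 V E / (C * ln (real n))\<rfloor> \<and>
    (\<forall>T\<in>\<T>. spanning_tree V E T \<and> rainbow \<phi> T) \<and> pairwise disjnt \<T>"
  \<comment> \<open>If \<open>q < 1\<close> the empty family suffices; this includes the case \<open>lambda1 V E \<le> 0\<close>.\<close>
  proof (cases "\<lfloor>q\<rfloor> \<le> 0")
    case True
    then show ?thesis unfolding q_def by (intro exI[of _ "{}"]) auto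
  next
    case False
    define t where "t = nat \<lfloor>q\<rfloor>"
    have t: "0 < t" "int t = \<lfloor>q\<rfloor>" using False by (auto simp: t_def)
    then have "real t \<le> q" by (metis of_int_floor_le of_int_of_nat_eq)
    have "0 < C * ln (real n)" using C n by (intro mult_pos_pos) auto
    then have "0 < ?\<delta>" using deg by linarith
    have min: "?\<delta> \<le> real (degree_of E v)" if "v \<in> V" for v
      using that G by (auto simp: min_degree_def simple_graph_def)
    have "\<exists>\<T>. finite \<T> \<and> card \<T> = t \<and> (\<forall>T\<in>\<T>. spanning_tree V E T \<and> rainbow \<phi> T) \<and> pairwise disjnt \<T>"
    proof (rule disjoint_rainbow_trees[OF C G _ \<open>0 < ?\<delta>\<close> min _ \<open>0 < t\<close>])
      show "real (card {e \<in> E. \<phi> e = k}) \<le> lambda1 V E * ?\<delta> / 2" for k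
        using col by (simp add: color_class_def mult.commute)
      show "real t \<le> lambda1 V E * ?\<delta> / (C * ln (real (card V)))"
        using \<open>real t \<le> q\<close> by (simp add: q_def card mult.commute)
    qed (use n card in simp)
    then obtain \<T> where "finite \<T>" "card \<T> = t" "\<forall>T\<in>\<T>. spanning_tree V E T \<and> rainbow \<phi> T" "pairwise disjnt \<T>"
      by blast
    then show ?thesis using t(2) unfolding q_def by (intro exI[of _ \<T>]) auto
  qed
qed

end
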